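(* Let $\mathbf{\Pi}$ be a BIBD permutation matrix of a $\mathrm{BIBD}(v,k,1,r,b)$, and let $\mathbf{F}$ and $\mathbf{G}$ be possibly-complex Hadamard matrices of size $k$ and $r+1$, respectively. Let $\mathbb{F}=\mathbb{R}$ if $\mathbf F$ and $\mathbf G$ are both real, and $\mathbb{F}=\mathbb{C}$ otherwise. Write $\mathbf{G}=\begin{bmatrix}\mathbf{G}_1&\mathbf{g}_2\end{bmatrix}$ where $\mathbf{G}_1$ is $(r+1)\times r$ and $\mathbf{g}_2$ is $(r+1)\times 1$. For any $l=1,\dotsc,k$, let $$\mathbf{\Phi}_l:=(\mathbf{I}_b\otimes\mathbf{f}_l^* )\,\mathbf{\Pi}\,(\mathbf{I}_v\otimes\mathbf{G}_1^* ),$$ where $\mathbf{f}_l$ is the $l$th column of $\mathbf{F}$. Then, for each $l$, the $v(r+1)$ columns of $\mathbf{\Phi}_l$ form an ETF for $\mathbb{F}^b$. Moreover, the row spaces of the matrices $\mathbf{\Phi}_1,\dotsc,\mathbf{\Phi}_k$ are mutually orthogonal, and the columns of $$\widetilde{\mathbf{\Phi}}_1=\begin{bmatrix}\mathbf{\Phi}_2\\ \vdots\\ \mathbf{\Phi}_k\\ \sqrt{k}\,(\mathbf{I}_v\otimes\mathbf{g}_2^* )\end{bmatrix}$$ form a Naimark complement for the ETF formed by the columns of $\mathbf{\Phi}_1$. Here, (for the given $\mathrm{BIBD}(v,k,1,r,b)$) both $\mathbf{F}$ and $\mathbf{G}$ can be chosen to be real if and only if $k=2$ and there exists a (real) Hadamard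 matrix of size $v$. In this case (i.e. when $\mathbf F$ and $\mathbf G$ are so chosen), the columns of $\mathbf{\Phi}_1$ and $\widetilde{\mathbf{\Phi}}_1$ form real ETFs of $v^2$ vectors for $\mathbb{R}^{\frac12v(v-1)}$ and $\mathbb{R}^{\frac12v(v+1)}$, respectively.
   Context: Let $\mathbb{F}$ be $\mathbb{R}$ or $\mathbb{C}$. A sequence of vectors $\{\varphi_j\}_{j=1}^n$ in $\mathbb{F}^d$ is identified with its synthesis operator, the $d\times n$ matrix $\mathbf\Phi$ whose $j$th column is $\varphi_j$; $\mathbf{\Phi}^*$ is the conjugate transpose. The sequence is an equiangular tight frame (ETF) for $\mathbb{F}^d$ if there exist $\beta>0$, $\gamma\ge0$, $\alpha>0$ such that $\|\varphi_j\|^2=\beta$ for all $j$, $|\langle\varphi_j,\varphi_{j'}\rangle|=\gamma$ for all $j\ne j'$, and $\mathbf{\Phi}\mathbf{\Phi}^*=\alpha\mathbf{I}$. A Naimark complement of such an ETF (with $n>d$) is the sequence of columns of an $(n-d)\times n$ matrix $\widetilde{\mathbf{\Phi}}$ over $\mathbb{F}$ such that $\alpha^{-1/2}\begin{bmatrix}\mathbf{\Phi}\\ \widetilde{\mathbf{\Phi}}\end{bmatrix}$ is unitary. A possibly-complex Hadamard matrix of size $m$ is an $m\times m$ real or complex matrix $\mathbf H$ with all entries of modulus one and $\mathbf H\mathbf H^*=m\mathbf I$; a (real) Hadamard matrix is one with all entries $\pm1$. Given integers $v>k>0$, $b>0$, $\lambda$, $r$, a $\mathrm{BIBD}(v,k,\lambda,r,b)$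 is a set of $v$ vertices together with $b$ subsets of it (blocks) such that each block contains exactly $k$ vertices, each vertex is in exactly $r$ blocks, and every pair of distinct vertices is in exactly $\lambda$ blocks. Its incidence matrix $\mathbf{X}$ is the $b\times v$ $\{0,1\}$-valued matrix with rows indexed by blocks and columns by vertices. One has $bk=vr$. If $\mathbf X$ is the $b\times v$ incidence matrix of a $\mathrm{BIBD}(v,k,1,r,b)$, a corresponding BIBD permutation matrix is a permutation matrix $\mathbf\Pi$ of size $bk=vr$ such that $\mathbf X=(\mathbf I_b\otimes\mathbf 1_k^{\mathrm T})\,\mathbf\Pi\,(\mathbf I_v\otimes\mathbf 1_r)$, where $\mathbf I_m$ is the $m\times m$ identity, $\mathbf 1_m$ is the $m\times1$ all-ones vector, and $\otimes$ is the Kronecker product. *)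

theory Defs
  imports
    Complex_Main
    "HOL-Library.Multiset"
    "HOL-Combinatorics.Permutations"
    "Jordan_Normal_Form.Schur_Decomposition"
begin

text \<open>
  Scalars: the field \<open>K\<close> is a set of complex numbers, either \<open>\<real>\<close> or \<open>UNIV\<close>.
  A matrix over \<open>K\<close> is a complex matrix all of whose entries lie in \<open>K\<close>; real matrices are
  thus complex matrices with real entries. Rows, columns and blocks are numbered from 0.
\<close>

definition mat_over :: "complex set \<Rightarrow> nat \<Rightarrow> nat \<Rightarrow> complex mat set" where
  "mat_over K m n = {A \<in> carrier_mat m n. elements_mat A \<subseteq> K}"

definition kronecker :: "'a::times mat \<Rightarrow> 'a mat \<Rightarrow> 'a mat"  (infixl "\<otimes>\<^sub>k" 70) where
  "A \<otimes>\<^sub>k B = mat (dim_row A * dim_row B) (dim_col A * dim_col B)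
     (\<lambda>(i, j). A $$ (i div dim_row B, j div dim_col B) * B $$ (i mod dim_row B, j mod dim_col B))"

definition ones_mat :: "nat \<Rightarrow> nat \<Rightarrow> complex mat" where
  "ones_mat m n = mat m n (\<lambda>_. 1)"

definition unitary_mat :: "nat \<Rightarrow> complex mat \<Rightarrow> bool" where
  "unitary_mat n U \<longleftrightarrow>
     U \<in> carrier_mat n n \<and> inverts_mat U (mat_adjoint U) \<and> inverts_mat (mat_adjoint U) U"

definition permutation_mat :: "nat \<Rightarrow> complex mat \<Rightarrow> bool" where
  "permutation_mat n P \<longleftrightarrow>
     (\<exists>p. p permutes {..<n} \<and> P = mat n n (\<lambda>(i, j). if i = p j then 1 else 0))"

text \<open>The span, with coefficients in \<open>K\<close>, of the rows of a matrix.\<close>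

definition row_space_over :: "complex set \<Rightarrow> complex mat \<Rightarrow> complex vec set" where
  "row_space_over K A =
     {transpose_mat A *\<^sub>v c | c. c \<in> carrier_vec (dim_row A) \<and> (\<forall>i<dim_row A. c $ i \<in> K)}"

definition orthogonal_spaces :: "complex vec set \<Rightarrow> complex vec set \<Rightarrow> bool" where
  "orthogonal_spaces S T \<longleftrightarrow> (\<forall>x\<in>S. \<forall>y\<in>T. x \<bullet>c y = 0)"

text \<open>The \<open>n\<close> columns of \<open>\<Phi>\<close> form an equiangular tight frame for \<open>K\<^sup>d\<close>.\<close>

definition is_etf :: "complex set \<Rightarrow> nat \<Rightarrow> nat \<Rightarrow> complex mat \<Rightarrow> bool" where
  "is_etf K d n \<Phi> \<longleftrightarrow>
     \<Phi> \<in> mat_over K d n \<and>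
     (\<exists>\<beta> \<gamma> \<alpha> :: real. \<beta> > 0 \<and> \<gamma> \<ge> 0 \<and> \<alpha> > 0 \<and>
       (\<forall>j<n. col \<Phi> j \<bullet>c col \<Phi> j = complex_of_real \<beta>) \<and>
       (\<forall>i<n. \<forall>j<n. i \<noteq> j \<longrightarrow> cmod (col \<Phi> i \<bullet>c col \<Phi> j) = \<gamma>) \<and>
       \<Phi> * mat_adjoint \<Phi> = complex_of_real \<alpha> \<cdot>\<^sub>m 1\<^sub>m d)"

definition naimark_complement ::
  "complex set \<Rightarrow> nat \<Rightarrow> nat \<Rightarrow> complex mat \<Rightarrow> complex mat \<Rightarrow> bool" where
  "naimark_complement K d n \<Phi> \<Psi> \<longleftrightarrow>
     is_etf K d n \<Phi> \<and> d < n \<and> \<Psi> \<in> mat_over K (n - d) n \<and>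
     (\<exists>\<alpha>::real. \<alpha> > 0 \<and> \<Phi> * mat_adjoint \<Phi> = complex_of_real \<alpha> \<cdot>\<^sub>m 1\<^sub>m d \<and>
        unitary_mat n (complex_of_real (1 / sqrt \<alpha>) \<cdot>\<^sub>m (\<Phi> @\<^sub>r \<Psi>)))"

definition hadamard :: "nat \<Rightarrow> complex mat \<Rightarrow> bool" where
  "hadamard m H \<longleftrightarrow>
     H \<in> carrier_mat m m \<and> (\<forall>i<m. \<forall>j<m. cmod (H $$ (i, j)) = 1) \<and>
     H * mat_adjoint H = of_nat m \<cdot>\<^sub>m 1\<^sub>m m"

definition real_hadamard :: "nat \<Rightarrow> complex mat \<Rightarrow> bool" where
  "real_hadamard m H \<longleftrightarrow> hadamard m H \<and> (\<forall>i<m. \<forall>j<m. H $$ (i, j) \<in> {1, -1})"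

text \<open>
  Blocks form a multiset, so repeated blocks are not excluded by definition (for \<open>lam = 1\<close> the
  conditions rule them out, as every block then contains a pair of distinct vertices).
\<close>

definition bibd ::
  "'p set \<Rightarrow> 'p set multiset \<Rightarrow> nat \<Rightarrow> nat \<Rightarrow> nat \<Rightarrow> nat \<Rightarrow> nat \<Rightarrow> bool" where
  "bibd V \<B> v k lam r b \<longleftrightarrow>
     v > k \<and> k > 0 \<and> b > 0 \<and> finite V \<and> card V = v \<and> size \<B> = b \<and>
     (\<forall>B\<in>#\<B>. B \<subseteq> V \<and> card B = k) \<and>
     (\<forall>x\<in>V. size (filter_mset (\<lambda>B. x \<in> B) \<B>) = r) \<and>
     (\<forall>x\<in>V. \<forall>y\<in>V. x \<noteq> y \<longrightarrow> size (filter_mset (\<lambda>B. x \<in> B \<and> y \<in> B) \<B>) = lam)"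

text \<open>An incidence matrix arises from any enumeration of the vertices and of the blocks.\<close>

definition incidence_matrix :: "'p set \<Rightarrow> 'p set multiset \<Rightarrow> complex mat \<Rightarrow> bool" where
  "incidence_matrix V \<B> X \<longleftrightarrow>
     (\<exists>vs bs. distinct vs \<and> set vs = V \<and> mset bs = \<B> \<and>
        X = mat (length bs) (length vs) (\<lambda>(i, j). if vs ! j \<in> bs ! i then 1 else 0))"

definition bibd_permutation_mat ::
  "nat \<Rightarrow> nat \<Rightarrow> nat \<Rightarrow> nat \<Rightarrow> complex mat \<Rightarrow> complex mat \<Rightarrow> bool" where
  "bibd_permutation_mat v k r b X P \<longleftrightarrow>
     permutation_mat (b * k) P \<and>
     X = (1\<^sub>m b \<otimes>\<^sub>k ones_mat 1 k) * P * (1\<^sub>m v \<otimes>\<^sub>k ones_mat r 1)"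

definition Phi ::
  "nat \<Rightarrow> nat \<Rightarrow> nat \<Rightarrow> nat \<Rightarrow> complex mat \<Rightarrow> complex mat \<Rightarrow> complex mat \<Rightarrow> nat \<Rightarrow> complex mat" where
  "Phi v k r b P F G l =
     (let f = mat k 1 (\<lambda>(i, _). F $$ (i, l));
          G1 = mat (r + 1) r (\<lambda>(i, j). G $$ (i, j))
      in (1\<^sub>m b \<otimes>\<^sub>k mat_adjoint f) * P * (1\<^sub>m v \<otimes>\<^sub>k mat_adjoint G1))"

definition Phi_tilde ::
  "nat \<Rightarrow> nat \<Rightarrow> nat \<Rightarrow> nat \<Rightarrow> complex mat \<Rightarrow> complex mat \<Rightarrow> complex mat \<Rightarrow> complex mat" where
  "Phi_tilde v k r b P F G =
     (let g2 = mat (r + 1) 1 (\<lambda>(i, _). G $$ (i, r))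
      in foldr (@\<^sub>r) (map (Phi v k r b P F G) [1..<k])
           (complex_of_real (sqrt (real k)) \<cdot>\<^sub>m (1\<^sub>m v \<otimes>\<^sub>k mat_adjoint g2)))"

end

theory Submission
  imports Defs
begin

text \<open>
  Products of Kronecker products give
  \<open>\<Phi>\<^sub>l \<Phi>\<^sub>m\<^sup>* = (r + 1) (I \<otimes> f\<^sub>l\<^sup>* f\<^sub>m) = k (r + 1) \<delta>\<^sub>l\<^sub>m I\<close>, and the
  rows of \<open>\<surd>k (I \<otimes> g\<^sub>2\<^sup>*)\<close> are orthogonal to all of these with the same norm, so the stacked
  matrix is a multiple of a unitary one. For equiangularity, the factorisation of the incidence
  matrix says that the permutation assigns to vertex \<open>x\<close> the \<open>r\<close> distinct blocks through it. Two
  columns at the same vertex have inner product a truncated Hadamard row product, missing one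
  unimodular term of a sum equal to 0; two columns at different vertices share exactly one block,
  which contributes one unimodular term.
\<close>

text \<open>Statements about rows are matrix algebra: they use only b k = v r and the unitarity of
  the permutation matrix, so tightness, orthogonality and the complement never look at which vertex
  lies in which block. Statements about columns of \<Phi> need the design, and they see it through a
  matching of slots: index x r + t is slot t at vertex x, and its image B k + s under the
  permutation is slot s in block B. The complement is again equiangular without a second look at the
  design, because the Gram matrices of an ETF and of its Naimark complement add up to a multiple of
  the identity. The claim about real matrices is arithmetic. For k = 2 the count r (k - 1) = v - 1
  gives r + 1 = v, so the required G is a Hadamard matrix of size v; for k > 2 real matrices would
  make both k and r + 1 multiples of 4, which is incompatible with the two counting identities of
  the design.\<close>

section \<open>Entries of products, adjoints and Gram matrices\<close>

lemma index_mult_mat_sum: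
  assumes "A \<in> carrier_mat m n" "B \<in> carrier_mat n l" "i < m" "j < l"
  shows "(A * B) $$ (i, j) = (\<Sum>a<n. A $$ (i, a) * B $$ (a, j))"
  using assms by (auto simp: scalar_prod_def lessThan_atLeast0 intro!: sum.cong)

lemma mat_adjoint_carrier [simp]:
  "A \<in> carrier_mat m n \<Longrightarrow> mat_adjoint A \<in> carrier_mat n m"
  by (auto simp: mat_adjoint_def)

lemma dim_mat_adjoint [simp]:
  "dim_row (mat_adjoint A) = dim_col A" "dim_col (mat_adjoint A) = dim_row A"
  by (auto simp: mat_adjoint_def)

lemma index_mat_adjoint [simp]:
  fixes A :: "complex mat"
  shows "i < dim_col A \<Longrightarrow> j < dim_row A \<Longrightarrow> mat_adjoint A $$ (i, j) = cnj (A $$ (j, i))"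
  by (simp add: mat_adjoint_def mat_of_rows_def)

lemma mat_adjoint_adjoint [simp]: "mat_adjoint (mat_adjoint A) = (A :: complex mat)"
  by (rule eq_matI) auto

lemma mat_adjoint_one [simp]: "mat_adjoint (1\<^sub>m n) = (1\<^sub>m n :: complex mat)"
  by (rule eq_matI) auto

lemma mat_adjoint_smult: "mat_adjoint (c \<cdot>\<^sub>m A) = cnj c \<cdot>\<^sub>m mat_adjoint (A :: complex mat)"
  by (rule eq_matI) auto

lemma mat_adjoint_zero [simp]: "mat_adjoint (0\<^sub>m m n) = (0\<^sub>m n m :: complex mat)"
  by (rule eq_matI) auto

lemma mat_adjoint_mult:
  fixes A B :: "complex mat"
  assumes "A \<in> carrier_mat m n" "B \<in> carrier_mat n l"
  shows "mat_adjoint (A * B) = mat_adjoint B * mat_adjoint A"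
proof (rule eq_matI)
  fix i j assume "i < dim_row (mat_adjoint B * mat_adjoint A)"
    "j < dim_col (mat_adjoint B * mat_adjoint A)"
  then have ij: "i < l" "j < m" using assms by auto
  have "mat_adjoint (A * B) $$ (i, j) = cnj ((A * B) $$ (j, i))"
    using assms ij by (subst index_mat_adjoint) auto
  also have "\<dots> = (\<Sum>a<n. mat_adjoint B $$ (i, a) * mat_adjoint A $$ (a, j))"
    using assms ij by (subst index_mult_mat_sum[OF assms]) (auto intro!: sum.cong)
  also have "\<dots> = (mat_adjoint B * mat_adjoint A) $$ (i, j)"
    using assms ij by (subst index_mult_mat_sum[of _ l n _ m]) auto
  finally show "mat_adjoint (A * B) $$ (i, j) = (mat_adjoint B * mat_adjoint A) $$ (i, j)" .
qed (use assms in auto)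

lemma zero_smult_mat: "A \<in> carrier_mat m n \<Longrightarrow> (0 :: complex) \<cdot>\<^sub>m A = 0\<^sub>m m n"
  by (intro eq_matI) auto

text \<open>The indices are swapped in the first claim because \<open>\<bullet>c\<close> conjugates
  its second argument, whereas the adjoint conjugates the left factor.\<close>

lemma index_gram_cols:
  fixes A :: "complex mat"
  assumes "A \<in> carrier_mat m n" "i < n" "j < n"
  shows "(mat_adjoint A * A) $$ (i, j) = col A j \<bullet>c col A i"
    and "col A i \<bullet>c col A j = (\<Sum>a<m. A $$ (a, i) * cnj (A $$ (a, j)))"
proof -
  have *: "col A i \<bullet>c col A j = (\<Sum>a<m. A $$ (a, i) * cnj (A $$ (a, j)))"
    if "i < n" "j < n" for i j
    using assms(1) that by (auto simp: scalar_prod_def lessThan_atLeast0 intro!: sum.cong)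
  show "(mat_adjoint A * A) $$ (i, j) = col A j \<bullet>c col A i"
    using assms by (subst index_mult_mat_sum[of _ n m _ n])
      (auto simp: * mult.commute intro!: sum.cong)
  show "col A i \<bullet>c col A j = (\<Sum>a<m. A $$ (a, i) * cnj (A $$ (a, j)))"
    using * assms by blast
qed

section \<open>Kronecker products\<close>

text \<open>Quotient and remainder identify the indices below m n with pairs. This is how the single
  index of a Kronecker product becomes a double sum.\<close>

lemma sum_div_mod:
  fixes f :: "nat \<Rightarrow> nat \<Rightarrow> 'a::comm_monoid_add"
  shows "(\<Sum>i<m * n. f (i div n) (i mod n)) = (\<Sum>a<m. \<Sum>c<n. f a c)"
proof -
  have "(\<Sum>i<m * n. f (i div n) (i mod n)) = (\<Sum>a<m. \<Sum>i\<in>{a * n..<a * n + n}. f (i div n) (i mod n))"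
    by (rule sum.nat_group[symmetric])
  also have "\<dots> = (\<Sum>a<m. \<Sum>c<n. f a c)"
  proof (rule sum.cong)
    fix a
    have "(\<Sum>i\<in>{0 + a * n..<n + a * n}. f (i div n) (i mod n)) = (\<Sum>c\<in>{0..<n}. f a c)"
      unfolding sum.shift_bounds_nat_ivl by (rule sum.cong) auto
    then show "(\<Sum>i\<in>{a * n..<a * n + n}. f (i div n) (i mod n)) = (\<Sum>c<n. f a c)"
      by (simp add: add.commute lessThan_atLeast0)
  qed simp
  finally show ?thesis .
qed

lemma sum_lessThan_add:
  fixes f :: "nat \<Rightarrow> 'a::comm_monoid_add"
  shows "(\<Sum>i<m + n. f i) = (\<Sum>i<m. f i) + (\<Sum>i<n. f (m + i))"
  by (induction n) (simp_all add: add.assoc)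

lemma sum_lessThan_mult:
  fixes f :: "nat \<Rightarrow> 'a::comm_monoid_add"
  shows "(\<Sum>i<m * n. f i) = (\<Sum>a<m. \<Sum>c<n. f (a * n + c))"
  using sum_div_mod[of "\<lambda>a c. f (a * n + c)" n m] by simp

lemma div_mod_less_mult: "(i::nat) < m * n \<Longrightarrow> i div n < m \<and> i mod n < n"
  by (metis less_mult_imp_div_less mod_less_divisor mult_0_right not_gr_zero not_less0)

lemma mult_add_less:
  assumes "x < v" "t < r"
  shows "x * r + t < v * (r :: nat)"
proof -
  have "x * r + t < Suc x * r" using assms by simp
  also have "\<dots> \<le> v * r" using assms by (intro mult_le_mono1) simp
  finally show ?thesis .
qed

lemma kronecker_carrier [simp]:
  "A \<in> carrier_mat m n \<Longrightarrow> B \<in> carrier_mat m' n' \<Longrightarrow> A \<otimes>\<^sub>k B \<in> carrier_mat (m * m') (n * n')"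
  by (simp add: kronecker_def carrier_matD)

lemma dim_kronecker [simp]:
  "dim_row (A \<otimes>\<^sub>k B) = dim_row A * dim_row B" "dim_col (A \<otimes>\<^sub>k B) = dim_col A * dim_col B"
  by (simp_all add: kronecker_def)

lemma index_kronecker:
  "i < dim_row A * dim_row B \<Longrightarrow> j < dim_col A * dim_col B \<Longrightarrow>
    (A \<otimes>\<^sub>k B) $$ (i, j) = A $$ (i div dim_row B, j div dim_col B) * B $$ (i mod dim_row B, j mod dim_col B)"
  by (simp add: kronecker_def)

text \<open>The mixed-product rule. The summation index splits into quotient and remainder by
  \<open>n'\<close>; the summand is a product of a function of each, so the double sum
  factors.\<close>

lemma kronecker_mult:
  fixes A B C D :: "complex mat"
  assumes "A \<in> carrier_mat m n" "C \<in> carrier_mat n l" "B \<in> carrier_mat m' n'" "D \<in> carrier_mat n' l'"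
  shows "(A \<otimes>\<^sub>k B) * (C \<otimes>\<^sub>k D) = (A * C) \<otimes>\<^sub>k (B * D)"
proof (rule eq_matI)
  fix i j assume "i < dim_row ((A * C) \<otimes>\<^sub>k (B * D))" "j < dim_col ((A * C) \<otimes>\<^sub>k (B * D))"
  then have ij: "i < m * m'" "j < l * l'" using assms by auto
  note dm = div_mod_less_mult[OF ij(1)] div_mod_less_mult[OF ij(2)]
  have "((A \<otimes>\<^sub>k B) * (C \<otimes>\<^sub>k D)) $$ (i, j) = (\<Sum>a<n * n'. (A \<otimes>\<^sub>k B) $$ (i, a) * (C \<otimes>\<^sub>k D) $$ (a, j))"
    using assms ij by (subst index_mult_mat_sum[of _ "m * m'" "n * n'" _ "l * l'"]) auto
  also have "\<dots> = (\<Sum>a<n * n'. (A $$ (i div m', a div n') * C $$ (a div n', j div l'))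
      * (B $$ (i mod m', a mod n') * D $$ (a mod n', j mod l')))"
    using assms ij by (intro sum.cong) (auto simp: index_kronecker algebra_simps)
  also have "\<dots> = (\<Sum>a<n. A $$ (i div m', a) * C $$ (a, j div l'))
      * (\<Sum>a<n'. B $$ (i mod m', a) * D $$ (a, j mod l'))"
    by (subst sum_div_mod[where f = "\<lambda>a c. (A $$ (i div m', a) * C $$ (a, j div l'))
      * (B $$ (i mod m', c) * D $$ (c, j mod l'))"]) (simp add: sum_product)
  also have "\<dots> = (A * C) $$ (i div m', j div l') * (B * D) $$ (i mod m', j mod l')"
    using assms dm by (simp add: index_mult_mat_sum[of A m n C l] index_mult_mat_sum[of B m' n' D l']
      del: index_mult_mat)
  also have "\<dots> = ((A * C) \<otimes>\<^sub>k (B * D)) $$ (i, j)"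
    using assms ij by (subst index_kronecker) auto
  finally show "((A \<otimes>\<^sub>k B) * (C \<otimes>\<^sub>k D)) $$ (i, j) = ((A * C) \<otimes>\<^sub>k (B * D)) $$ (i, j)" .
qed (use assms in auto)

lemma mat_adjoint_kronecker:
  fixes A B :: "complex mat"
  shows "mat_adjoint (A \<otimes>\<^sub>k B) = mat_adjoint A \<otimes>\<^sub>k mat_adjoint B"
proof (rule eq_matI)
  fix i j assume ij: "i < dim_row (mat_adjoint A \<otimes>\<^sub>k mat_adjoint B)" "j < dim_col (mat_adjoint A \<otimes>\<^sub>k mat_adjoint B)"
  then have "i < dim_col A * dim_col B" "j < dim_row A * dim_row B" by auto
  note div_mod_less_mult[OF this(1)] div_mod_less_mult[OF this(2)]
  then show "mat_adjoint (A \<otimes>\<^sub>k B) $$ (i, j) = (mat_adjoint A \<otimes>\<^sub>k mat_adjoint B) $$ (i, j)"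
    using ij by (simp add: index_kronecker)
qed auto

lemma kronecker_smult_right: "A \<otimes>\<^sub>k (c \<cdot>\<^sub>m B) = c \<cdot>\<^sub>m (A \<otimes>\<^sub>k (B :: complex mat))"
proof (rule eq_matI)
  fix i j assume ij: "i < dim_row (c \<cdot>\<^sub>m (A \<otimes>\<^sub>k B))" "j < dim_col (c \<cdot>\<^sub>m (A \<otimes>\<^sub>k B))"
  then have "i < dim_row A * dim_row B" "j < dim_col A * dim_col B" by auto
  note div_mod_less_mult[OF this(1)] div_mod_less_mult[OF this(2)]
  then show "(A \<otimes>\<^sub>k (c \<cdot>\<^sub>m B)) $$ (i, j) = (c \<cdot>\<^sub>m (A \<otimes>\<^sub>k B)) $$ (i, j)"
    using ij by (simp add: index_kronecker)
qed auto

lemma kronecker_one: "(1\<^sub>m m \<otimes>\<^sub>k 1\<^sub>m n :: complex mat) = 1\<^sub>m (m * n)"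
proof (rule eq_matI)
  fix i j assume ij: "i < dim_row (1\<^sub>m (m * n))" "j < dim_col (1\<^sub>m (m * n))"
  then have "i < m * n" "j < m * n" by auto
  note div_mod_less_mult[OF this(1)] div_mod_less_mult[OF this(2)]
  moreover have "i = j \<longleftrightarrow> i div n = j div n \<and> i mod n = j mod n"
    by (metis div_mult_mod_eq)
  ultimately show "(1\<^sub>m m \<otimes>\<^sub>k 1\<^sub>m n) $$ (i, j) = (1\<^sub>m (m * n) :: complex mat) $$ (i, j)"
    using ij by (auto simp: index_kronecker)
qed auto

lemma kronecker_zero_right: "A \<otimes>\<^sub>k 0\<^sub>m m n = (0\<^sub>m (dim_row A * m) (dim_col A * n) :: complex mat)"
proof (rule eq_matI)
  fix i j assume ij: "i < dim_row (0\<^sub>m (dim_row A * m) (dim_col A * n) :: complex mat)"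
    "j < dim_col (0\<^sub>m (dim_row A * m) (dim_col A * n) :: complex mat)"
  then have "i < dim_row A * m" "j < dim_col A * n" by auto
  note div_mod_less_mult[OF this(1)] div_mod_less_mult[OF this(2)]
  then show "(A \<otimes>\<^sub>k 0\<^sub>m m n) $$ (i, j) = (0\<^sub>m (dim_row A * m) (dim_col A * n) :: complex mat) $$ (i, j)"
    using ij by (simp add: index_kronecker)
qed auto

section \<open>Permutation matrices between Kronecker factors\<close>

text \<open>Entry (i, j) counts the a with \<open>p a = i\<close> and \<open>p a = j\<close>.
  Reindexing the sum by \<open>p\<close> turns this into a Kronecker delta.\<close>

lemma permutation_mat_unitary:
  assumes "p permutes {..<n}"
  defines "P \<equiv> mat n n (\<lambda>(i, j). if i = p j then 1 else 0) :: complex mat"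
  shows "P * mat_adjoint P = 1\<^sub>m n"
proof (rule eq_matI)
  fix i j assume "i < dim_row (1\<^sub>m n :: complex mat)" "j < dim_col (1\<^sub>m n :: complex mat)"
  then have ij: "i < n" "j < n" by auto
  have P: "P \<in> carrier_mat n n" by (simp add: P_def)
  have "(P * mat_adjoint P) $$ (i, j) = (\<Sum>a<n. P $$ (i, a) * mat_adjoint P $$ (a, j))"
    using P ij by (intro index_mult_mat_sum) auto
  also have "\<dots> = (\<Sum>a<n. ((\<lambda>a. if i = a then if j = a then 1 else 0 else 0) \<circ> p) a)"
    using ij P by (intro sum.cong) (auto simp: P_def)
  also have "\<dots> = (\<Sum>a<n. if i = a then if j = a then 1 else 0 else 0)"
    by (rule sum.permute[OF assms(1), symmetric])
  also have "\<dots> = (1\<^sub>m n :: complex mat) $$ (i, j)"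
    using ij by simp
  finally show "(P * mat_adjoint P) $$ (i, j) = (1\<^sub>m n :: complex mat) $$ (i, j)" .
qed (auto simp: P_def)

text \<open>Slot t of vertex \<open>y div m\<close> contributes exactly when \<open>p\<close> sends
  it into block \<open>B\<close>. The formula is used twice: with conjugated Hadamard columns for
  \<open>C\<close> and \<open>D\<close> it gives the entries of \<open>Phi\<close>, with all-ones
  matrices it gives the incidence matrix.\<close>

lemma index_kronecker_permutation:
  fixes C D :: "complex mat"
  assumes p: "p permutes {..<b * k}" and bk: "b * k = v * r"
    and C: "C \<in> carrier_mat 1 k" and D: "D \<in> carrier_mat r m"
    and B: "B < b" and y: "y < v * m"
  defines "P \<equiv> mat (b * k) (b * k) (\<lambda>(i, j). if i = p j then 1 else 0)"
  shows "((1\<^sub>m b \<otimes>\<^sub>k C) * P * (1\<^sub>m v \<otimes>\<^sub>k D)) $$ (B, y) =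
    (\<Sum>t<r. (if p (y div m * r + t) div k = B then C $$ (0, p (y div m * r + t) mod k) else 0)
      * D $$ (t, y mod m))"
proof -
  have P: "P \<in> carrier_mat (b * k) (b * k)" by (simp add: P_def)
  have y': "y div m < v" using div_mod_less_mult[OF y] by simp
  have CP: "(1\<^sub>m b \<otimes>\<^sub>k C) * P \<in> carrier_mat b (v * r)" using C P bk by auto
  have left: "((1\<^sub>m b \<otimes>\<^sub>k C) * P) $$ (B, j) = (if p j div k = B then C $$ (0, p j mod k) else 0)"
    if j: "j < b * k" for j
  proof -
    have pj: "p j < b * k" using permutes_in_image[OF p, of j] j by auto
    note pj' = div_mod_less_mult[OF pj]
    have "((1\<^sub>m b \<otimes>\<^sub>k C) * P) $$ (B, j) = (\<Sum>a<b * k. (1\<^sub>m b \<otimes>\<^sub>k C) $$ (B, a) * P $$ (a, j))"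
      using C P B j by (intro index_mult_mat_sum[of _ b _ _ "b * k"]) auto
    also have "\<dots> = (\<Sum>a<b * k. if a = p j then (1\<^sub>m b \<otimes>\<^sub>k C) $$ (B, a) else 0)"
      using j by (intro sum.cong) (auto simp: P_def)
    also have "\<dots> = (1\<^sub>m b \<otimes>\<^sub>k C) $$ (B, p j)"
      using pj by simp
    also have "\<dots> = (if p j div k = B then C $$ (0, p j mod k) else 0)"
      using C B pj pj' by (auto simp: index_kronecker)
    finally show ?thesis .
  qed
  let ?L = "\<lambda>j. (if p j div k = B then C $$ (0, p j mod k) else 0)"
  have "((1\<^sub>m b \<otimes>\<^sub>k C) * P * (1\<^sub>m v \<otimes>\<^sub>k D)) $$ (B, y)
      = (\<Sum>j<v * r. ((1\<^sub>m b \<otimes>\<^sub>k C) * P) $$ (B, j) * (1\<^sub>m v \<otimes>\<^sub>k D) $$ (j, y))"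
    using CP D B y by (intro index_mult_mat_sum) auto
  also have "\<dots> = (\<Sum>j<v * r. ?L j * (if j div r = y div m then D $$ (j mod r, y mod m) else 0))"
    using D y y' left bk by (intro sum.cong) (auto simp: index_kronecker div_mod_less_mult)
  \<comment> \<open>Sorting the slots by vertex, the identity factor keeps only the vertex
    \<open>y div m\<close>.\<close>
  also have "\<dots> = (\<Sum>x<v. \<Sum>t<r. ?L (x * r + t) * (if x = y div m then D $$ (t, y mod m) else 0))"
    by (subst sum_lessThan_mult) (auto intro!: sum.cong)
  also have "\<dots> = (\<Sum>x<v. if x = y div m then \<Sum>t<r. ?L (x * r + t) * D $$ (t, y mod m) else 0)"
    by (intro sum.cong) auto
  also have "\<dots> = (\<Sum>t<r. ?L (y div m * r + t) * D $$ (t, y mod m))"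
    using y' by simp
  finally show ?thesis .
qed

section \<open>Stacking matrices with mutually orthogonal rows\<close>

lemma index_mult_adjoint:
  fixes A B :: "complex mat"
  assumes "A \<in> carrier_mat m n" "B \<in> carrier_mat l n" "i < m" "j < l"
  shows "(A * mat_adjoint B) $$ (i, j) = (\<Sum>a<n. A $$ (i, a) * cnj (B $$ (j, a)))"
  using assms by (subst index_mult_mat_sum[of _ m n _ l]) (auto intro!: sum.cong)

lemma mult_adjoint_zero_sym:
  fixes A B :: "complex mat"
  assumes "A \<in> carrier_mat m n" "B \<in> carrier_mat l n" "A * mat_adjoint B = 0\<^sub>m m l"
  shows "B * mat_adjoint A = 0\<^sub>m l m"
  using arg_cong[OF assms(3), of mat_adjoint] assms(1,2)
  by (simp add: mat_adjoint_mult[of A m n "mat_adjoint B" l])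

lemma index_append_rows:
  assumes "A \<in> carrier_mat m n" "B \<in> carrier_mat l n" "i < m + l" "j < n"
  shows "(A @\<^sub>r B) $$ (i, j) = (if i < m then A $$ (i, j) else B $$ (i - m, j))"
  using assms by (auto simp: append_rows_def)

lemma mult_adjoint_append_rows:
  fixes A B C :: "complex mat"
  assumes C: "C \<in> carrier_mat c n" and A: "A \<in> carrier_mat m n" and B: "B \<in> carrier_mat l n"
    and "i < c" "j < m + l"
  shows "(C * mat_adjoint (A @\<^sub>r B)) $$ (i, j) =
    (if j < m then (C * mat_adjoint A) $$ (i, j) else (C * mat_adjoint B) $$ (i, j - m))"
  using assms
  by (simp add: index_mult_adjoint[OF C carrier_append_rows[OF A B]] index_mult_adjoint[OF C A]
      index_mult_adjoint[OF C B] index_append_rows[OF A B] del: index_mult_mat)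

lemma mult_adjoint_append_rows_zero:
  fixes A B C :: "complex mat"
  assumes C: "C \<in> carrier_mat c n" and A: "A \<in> carrier_mat m n" and B: "B \<in> carrier_mat l n"
    and "C * mat_adjoint A = 0\<^sub>m c m" "C * mat_adjoint B = 0\<^sub>m c l"
  shows "C * mat_adjoint (A @\<^sub>r B) = 0\<^sub>m c (m + l)"
proof (rule eq_matI)
  fix i j assume "i < dim_row (0\<^sub>m c (m + l) :: complex mat)" "j < dim_col (0\<^sub>m c (m + l) :: complex mat)"
  then show "(C * mat_adjoint (A @\<^sub>r B)) $$ (i, j) = 0\<^sub>m c (m + l) $$ (i, j)"
    using assms by (simp add: mult_adjoint_append_rows[OF C A B] del: index_mult_mat(1))
qed (use C carrier_append_rows[OF A B] in \<open>auto simp: carrier_matD\<close>)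

lemma append_rows_tight:
  fixes A B :: "complex mat"
  assumes A: "A \<in> carrier_mat m n" and B: "B \<in> carrier_mat l n"
    and AA: "A * mat_adjoint A = \<alpha> \<cdot>\<^sub>m 1\<^sub>m m" and BB: "B * mat_adjoint B = \<alpha> \<cdot>\<^sub>m 1\<^sub>m l"
    and AB: "A * mat_adjoint B = 0\<^sub>m m l"
  shows "(A @\<^sub>r B) * mat_adjoint (A @\<^sub>r B) = \<alpha> \<cdot>\<^sub>m 1\<^sub>m (m + l)"
proof (rule eq_matI)
  note W = carrier_append_rows[OF A B]
  note BA = mult_adjoint_zero_sym[OF A B AB]
  fix i j assume "i < dim_row (\<alpha> \<cdot>\<^sub>m 1\<^sub>m (m + l))" "j < dim_col (\<alpha> \<cdot>\<^sub>m 1\<^sub>m (m + l))"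
  then have ij: "i < m + l" "j < m + l" by auto
  have "((A @\<^sub>r B) * mat_adjoint (A @\<^sub>r B)) $$ (i, j) =
      (if i < m then (A * mat_adjoint (A @\<^sub>r B)) $$ (i, j)
       else (B * mat_adjoint (A @\<^sub>r B)) $$ (i - m, j))"
    using ij by (simp add: index_mult_adjoint[OF W W] index_mult_adjoint[OF A W]
        index_mult_adjoint[OF B W] index_append_rows[OF A B] del: index_mult_mat)
  then show "((A @\<^sub>r B) * mat_adjoint (A @\<^sub>r B)) $$ (i, j) = (\<alpha> \<cdot>\<^sub>m 1\<^sub>m (m + l)) $$ (i, j)"
    using ij
    by (auto simp: mult_adjoint_append_rows[OF A A B] mult_adjoint_append_rows[OF B A B] AA BB AB BA
        simp del: index_mult_mat(1))
qed (use carrier_append_rows[OF A B] in \<open>auto simp: carrier_matD\<close>)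

lemma foldr_append_rows_carrier:
  assumes "\<And>l. l \<in> set ls \<Longrightarrow> f l \<in> carrier_mat m n" "Z \<in> carrier_mat z n"
  shows "foldr (@\<^sub>r) (map f ls) Z \<in> carrier_mat (length ls * m + z) n"
  using assms by (induction ls) (auto simp: add.assoc intro!: carrier_append_rows)

lemma mult_adjoint_foldr_append_rows_zero:
  fixes C :: "complex mat"
  assumes "C \<in> carrier_mat c n" "Z \<in> carrier_mat z n" "C * mat_adjoint Z = 0\<^sub>m c z"
    and "\<And>l. l \<in> set ls \<Longrightarrow> f l \<in> carrier_mat m n"
    and "\<And>l. l \<in> set ls \<Longrightarrow> C * mat_adjoint (f l) = 0\<^sub>m c m"
  shows "C * mat_adjoint (foldr (@\<^sub>r) (map f ls) Z) = 0\<^sub>m c (length ls * m + z)"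
  using assms(4,5)
proof (induction ls)
  case Nil
  then show ?case using assms by simp
next
  case (Cons l ls)
  have "foldr (@\<^sub>r) (map f ls) Z \<in> carrier_mat (length ls * m + z) n"
    using Cons.prems assms(2) by (intro foldr_append_rows_carrier) auto
  from mult_adjoint_append_rows_zero[OF assms(1) _ this, of "f l" m] Cons
  show ?case by (simp add: add.assoc)
qed

text \<open>Induction on the list: the head is orthogonal to every later block and to
  \<open>Z\<close>, hence to their stack, and \<open>append_rows_tight\<close> glues the two. All
  blocks need the same \<open>\<alpha>\<close>.\<close>

lemma foldr_append_rows_tight:
  fixes Z :: "complex mat"
  assumes "Z \<in> carrier_mat z n" "Z * mat_adjoint Z = \<alpha> \<cdot>\<^sub>m 1\<^sub>m z" "distinct ls"
    and "\<And>l. l \<in> set ls \<Longrightarrow> f l \<in> carrier_mat m n"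
    and "\<And>l. l \<in> set ls \<Longrightarrow> f l * mat_adjoint Z = 0\<^sub>m m z"
    and "\<And>l. l \<in> set ls \<Longrightarrow> f l * mat_adjoint (f l) = \<alpha> \<cdot>\<^sub>m 1\<^sub>m m"
    and "\<And>l l'. l \<in> set ls \<Longrightarrow> l' \<in> set ls \<Longrightarrow> l \<noteq> l' \<Longrightarrow> f l * mat_adjoint (f l') = 0\<^sub>m m m"
  shows "foldr (@\<^sub>r) (map f ls) Z * mat_adjoint (foldr (@\<^sub>r) (map f ls) Z)
    = \<alpha> \<cdot>\<^sub>m 1\<^sub>m (length ls * m + z)"
  using assms(3-)
proof (induction ls)
  case Nil
  then show ?case using assms by simp
next
  case (Cons l ls)
  have W: "foldr (@\<^sub>r) (map f ls) Z \<in> carrier_mat (length ls * m + z) n"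
    using Cons.prems assms(1) by (intro foldr_append_rows_carrier) auto
  have "f l * mat_adjoint (foldr (@\<^sub>r) (map f ls) Z) = 0\<^sub>m m (length ls * m + z)"
  proof (intro mult_adjoint_foldr_append_rows_zero[where n = n])
    show "f l * mat_adjoint (f l') = 0\<^sub>m m m" if "l' \<in> set ls" for l'
      using that Cons.prems(1) by (intro Cons.prems(5)) auto
  qed (use Cons.prems assms(1) in auto)
  from append_rows_tight[OF _ W _ _ this] Cons
  show ?case by (simp add: add.assoc)
qed

section \<open>Scalars and row spaces\<close>

lemma mat_over_iff:
  "A \<in> mat_over K m n \<longleftrightarrow> A \<in> carrier_mat m n \<and> (\<forall>i<m. \<forall>j<n. A $$ (i, j) \<in> K)"
  by (fastforce simp: mat_over_def)

lemma mat_over_append_rows: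
  assumes "A \<in> mat_over K m n" "B \<in> mat_over K l n"
  shows "A @\<^sub>r B \<in> mat_over K (m + l) n"
  using assms by (auto simp: mat_over_iff index_append_rows)

lemma mat_over_foldr_append_rows:
  assumes "\<And>l. l \<in> set ls \<Longrightarrow> f l \<in> mat_over K m n" "Z \<in> mat_over K z n"
  shows "foldr (@\<^sub>r) (map f ls) Z \<in> mat_over K (length ls * m + z) n"
  using assms by (induction ls) (auto simp: add.assoc intro!: mat_over_append_rows)

text \<open>Expanding both linear combinations and summing over the columns first leaves the entries
  of \<open>A * mat_adjoint B\<close> as coefficients. The same computation covers real and complex
  coefficients.\<close>

lemma orthogonal_row_spaces:
  assumes A: "A \<in> carrier_mat m n" and B: "B \<in> carrier_mat l n"
    and AB: "A * mat_adjoint B = 0\<^sub>m m l"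
  shows "orthogonal_spaces (row_space_over K A) (row_space_over K B)"
proof -
  have "(transpose_mat A *\<^sub>v c) \<bullet>c (transpose_mat B *\<^sub>v d) = 0"
    if c: "c \<in> carrier_vec m" and d: "d \<in> carrier_vec l" for c d
  proof -
    have "(transpose_mat A *\<^sub>v c) \<bullet>c (transpose_mat B *\<^sub>v d)
        = (\<Sum>a<n. (\<Sum>i<m. A $$ (i, a) * c $ i) * (\<Sum>j<l. cnj (B $$ (j, a)) * cnj (d $ j)))"
      using A B c d
      by (auto simp: scalar_prod_def lessThan_atLeast0 conjugate_vec_def cnj_sum intro!: sum.cong)
    also have "\<dots> = (\<Sum>a<n. \<Sum>i<m. \<Sum>j<l. A $$ (i, a) * cnj (B $$ (j, a)) * (c $ i * cnj (d $ j)))"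
      by (simp add: sum_product algebra_simps)
    also have "\<dots> = (\<Sum>i<m. \<Sum>a<n. \<Sum>j<l. A $$ (i, a) * cnj (B $$ (j, a)) * (c $ i * cnj (d $ j)))"
      by (rule sum.swap)
    also have "\<dots> = (\<Sum>i<m. \<Sum>j<l. \<Sum>a<n. A $$ (i, a) * cnj (B $$ (j, a)) * (c $ i * cnj (d $ j)))"
      by (intro sum.cong refl sum.swap)
    also have "\<dots> = (\<Sum>i<m. \<Sum>j<l. (A * mat_adjoint B) $$ (i, j) * (c $ i * cnj (d $ j)))"
      by (simp add: index_mult_adjoint[OF A B] sum_distrib_right del: index_mult_mat)
    also have "\<dots> = 0"
      by (simp add: AB)
    finally show ?thesis .
  qed
  then show ?thesis
    using A B by (auto simp: orthogonal_spaces_def row_space_over_def)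
qed

section \<open>Multiples of unitary matrices and Naimark complements\<close>

text \<open>A right inverse of a square matrix is a left inverse, and \<open>mat_adjoint U\<close>
  divided by \<open>\<alpha>\<close> is a right inverse. This is the passage from orthogonal rows to
  orthogonal columns, for Hadamard matrices as well as for the stacked matrix.\<close>

lemma tight_square_adjoint_mult:
  fixes U :: "complex mat"
  assumes U: "U \<in> carrier_mat n n" and "\<alpha> \<noteq> 0" and UU: "U * mat_adjoint U = \<alpha> \<cdot>\<^sub>m 1\<^sub>m n"
  shows "mat_adjoint U * U = \<alpha> \<cdot>\<^sub>m 1\<^sub>m n"
proof -
  have "U * ((1 / \<alpha>) \<cdot>\<^sub>m mat_adjoint U) = (1 / \<alpha>) \<cdot>\<^sub>m (U * mat_adjoint U)"
    using U by (intro mult_smult_distrib) auto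
  also have "\<dots> = 1\<^sub>m n"
    unfolding UU using \<open>\<alpha> \<noteq> 0\<close> by (intro eq_matI) auto
  finally have "((1 / \<alpha>) \<cdot>\<^sub>m mat_adjoint U) * U = 1\<^sub>m n"
    using U by (intro mat_mult_left_right_inverse[of U]) auto
  moreover have "((1 / \<alpha>) \<cdot>\<^sub>m mat_adjoint U) * U = (1 / \<alpha>) \<cdot>\<^sub>m (mat_adjoint U * U)"
    using U by (intro mult_smult_assoc_mat[of _ n n]) auto
  ultimately have "\<alpha> \<cdot>\<^sub>m 1\<^sub>m n = \<alpha> \<cdot>\<^sub>m ((1 / \<alpha>) \<cdot>\<^sub>m (mat_adjoint U * U))" by simp
  also have "\<dots> = mat_adjoint U * U"
    using \<open>\<alpha> \<noteq> 0\<close> by (intro eq_matI) auto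
  finally show ?thesis by simp
qed

text \<open>The scaling factor enters twice, giving 1 / \<alpha>. Of the two inverse conditions in
  \<open>unitary_mat\<close> the row condition implies the other by
  \<open>tight_square_adjoint_mult\<close>.\<close>

lemma unitary_mat_scaled_iff:
  assumes U: "U \<in> carrier_mat n n" and "\<alpha> > 0"
  shows "unitary_mat n (complex_of_real (1 / sqrt \<alpha>) \<cdot>\<^sub>m U) \<longleftrightarrow>
    U * mat_adjoint U = complex_of_real \<alpha> \<cdot>\<^sub>m 1\<^sub>m n"
proof -
  define s where "s = complex_of_real (1 / sqrt \<alpha>)"
  have s2: "s * s = 1 / complex_of_real \<alpha>" "cnj s = s"
    using \<open>\<alpha> > 0\<close> by (auto simp: s_def simp flip: of_real_mult)
  have scale: "(s \<cdot>\<^sub>m A) * (s \<cdot>\<^sub>m B) = (1 / complex_of_real \<alpha>) \<cdot>\<^sub>m (A * B)"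
    if "A \<in> carrier_mat n n" "B \<in> carrier_mat n n" for A B
  proof -
    have "(s \<cdot>\<^sub>m A) * (s \<cdot>\<^sub>m B) = s \<cdot>\<^sub>m (s \<cdot>\<^sub>m (A * B))"
      using that by (simp add: mult_smult_distrib[of _ n n] mult_smult_assoc_mat[of _ n n])
    also have "\<dots> = (s * s) \<cdot>\<^sub>m (A * B)"
      by (intro eq_matI) auto
    finally show ?thesis by (simp add: s2)
  qed
  have eq: "(1 / complex_of_real \<alpha>) \<cdot>\<^sub>m M = 1\<^sub>m n \<longleftrightarrow> M = complex_of_real \<alpha> \<cdot>\<^sub>m 1\<^sub>m n"
    if "M \<in> carrier_mat n n" for M
  proof
    assume "(1 / complex_of_real \<alpha>) \<cdot>\<^sub>m M = 1\<^sub>m n"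
    then have "complex_of_real \<alpha> \<cdot>\<^sub>m 1\<^sub>m n = complex_of_real \<alpha> \<cdot>\<^sub>m ((1 / complex_of_real \<alpha>) \<cdot>\<^sub>m M)"
      by simp
    also have "\<dots> = M" using \<open>\<alpha> > 0\<close> that by (intro eq_matI) auto
    finally show "M = complex_of_real \<alpha> \<cdot>\<^sub>m 1\<^sub>m n" by simp
  next
    assume "M = complex_of_real \<alpha> \<cdot>\<^sub>m 1\<^sub>m n"
    then show "(1 / complex_of_real \<alpha>) \<cdot>\<^sub>m M = 1\<^sub>m n"
      using \<open>\<alpha> > 0\<close> by (intro eq_matI) auto
  qed
  have "unitary_mat n (s \<cdot>\<^sub>m U) \<longleftrightarrow> U * mat_adjoint U = complex_of_real \<alpha> \<cdot>\<^sub>m 1\<^sub>m n \<and>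
      mat_adjoint U * U = complex_of_real \<alpha> \<cdot>\<^sub>m 1\<^sub>m n"
    using U eq[OF mult_carrier_mat, of U n "mat_adjoint U"] eq[OF mult_carrier_mat, of "mat_adjoint U" n U]
    by (auto simp: unitary_mat_def inverts_mat_def mat_adjoint_smult s2 scale)
  then show ?thesis
    using tight_square_adjoint_mult[OF U] \<open>\<alpha> > 0\<close> by (auto simp: s_def)
qed

text \<open>The columns of the stack are orthogonal with squared norm \<alpha>. Hence distinct
  columns of \<Psi> have minus the inner product of the corresponding columns of \<Phi>, which has
  the same modulus, and the squared norms become \<alpha> - \<beta>.\<close>

lemma naimark_complement_etf:
  assumes "naimark_complement K d n \<Phi> \<Psi>"
  shows "is_etf K (n - d) n \<Psi>"
proof -
  from assms obtain \<alpha> :: real where etf: "is_etf K d n \<Phi>" and "d < n"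
    and \<Psi>: "\<Psi> \<in> mat_over K (n - d) n" and "\<alpha> > 0"
    and \<Phi>\<Phi>: "\<Phi> * mat_adjoint \<Phi> = complex_of_real \<alpha> \<cdot>\<^sub>m 1\<^sub>m d"
    and unitary: "unitary_mat n (complex_of_real (1 / sqrt \<alpha>) \<cdot>\<^sub>m (\<Phi> @\<^sub>r \<Psi>))"
    by (auto simp: naimark_complement_def)
  from etf obtain \<beta> \<gamma> :: real where \<Phi>: "\<Phi> \<in> carrier_mat d n" and "\<gamma> \<ge> 0"
    and \<beta>: "\<And>j. j < n \<Longrightarrow> col \<Phi> j \<bullet>c col \<Phi> j = complex_of_real \<beta>"
    and \<gamma>: "\<And>i j. i < n \<Longrightarrow> j < n \<Longrightarrow> i \<noteq> j \<Longrightarrow> cmod (col \<Phi> i \<bullet>c col \<Phi> j) = \<gamma>"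
    by (auto simp: is_etf_def mat_over_def)
  have \<Psi>c: "\<Psi> \<in> carrier_mat (n - d) n" using \<Psi> by (simp add: mat_over_def)
  define U where "U = \<Phi> @\<^sub>r \<Psi>"
  have U: "U \<in> carrier_mat n n"
    using carrier_append_rows[OF \<Phi> \<Psi>c] \<open>d < n\<close> by (simp add: U_def)
  have UU: "U * mat_adjoint U = complex_of_real \<alpha> \<cdot>\<^sub>m 1\<^sub>m n"
    using unitary unitary_mat_scaled_iff[OF U \<open>\<alpha> > 0\<close>] by (simp add: U_def)
  have U'U: "mat_adjoint U * U = complex_of_real \<alpha> \<cdot>\<^sub>m 1\<^sub>m n"
    using tight_square_adjoint_mult[OF U _ UU] \<open>\<alpha> > 0\<close> by simp
  \<comment> \<open>This product is the lower right corner of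
    \<open>U * mat_adjoint U\<close>.\<close>
  have \<Psi>\<Psi>: "\<Psi> * mat_adjoint \<Psi> = complex_of_real \<alpha> \<cdot>\<^sub>m 1\<^sub>m (n - d)"
  proof (rule eq_matI)
    fix i j assume ij: "i < dim_row (complex_of_real \<alpha> \<cdot>\<^sub>m 1\<^sub>m (n - d))"
      "j < dim_col (complex_of_real \<alpha> \<cdot>\<^sub>m 1\<^sub>m (n - d))"
    have "(\<Psi> * mat_adjoint \<Psi>) $$ (i, j) = (U * mat_adjoint U) $$ (d + i, d + j)"
      using ij \<open>d < n\<close> by (simp add: index_mult_adjoint[OF \<Psi>c \<Psi>c] index_mult_adjoint[OF U U]
          del: index_mult_mat) (simp add: U_def index_append_rows[OF \<Phi> \<Psi>c])
    then show "(\<Psi> * mat_adjoint \<Psi>) $$ (i, j) = (complex_of_real \<alpha> \<cdot>\<^sub>m 1\<^sub>m (n - d)) $$ (i, j)"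
      using ij \<open>d < n\<close> by (simp add: UU)
  qed (use \<Psi>c in auto)
  have inner: "col \<Psi> i \<bullet>c col \<Psi> j = (if i = j then complex_of_real \<alpha> else 0) - col \<Phi> i \<bullet>c col \<Phi> j"
    if "i < n" "j < n" for i j
  proof -
    have "(if i = j then complex_of_real \<alpha> else 0) = col U i \<bullet>c col U j"
      using index_gram_cols(1)[OF U that(2,1)] that by (auto simp: U'U)
    also have "\<dots> = (\<Sum>a<d + (n - d). U $$ (a, i) * cnj (U $$ (a, j)))"
      using index_gram_cols(2)[OF U that] \<open>d < n\<close> by simp
    also have "\<dots> = (\<Sum>a<d. U $$ (a, i) * cnj (U $$ (a, j)))
        + (\<Sum>a<n - d. U $$ (d + a, i) * cnj (U $$ (d + a, j)))"
      by (rule sum_lessThan_add)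
    also have "\<dots> = col \<Phi> i \<bullet>c col \<Phi> j + col \<Psi> i \<bullet>c col \<Psi> j"
      using that \<open>d < n\<close>
      by (simp add: index_gram_cols(2)[OF \<Phi> that] index_gram_cols(2)[OF \<Psi>c that] U_def
          index_append_rows[OF \<Phi> \<Psi>c])
    finally show ?thesis by simp
  qed
  \<comment> \<open>Positivity of \<alpha> - \<beta>: the sum of all squared moduli of entries of
    \<Phi> is n \<beta> by columns and d \<alpha> by rows, and d < n.\<close>
  have "complex_of_real (n * \<beta>) = (\<Sum>j<n. col \<Phi> j \<bullet>c col \<Phi> j)"
    using \<beta> by simp
  also have "\<dots> = (\<Sum>j<n. \<Sum>a<d. \<Phi> $$ (a, j) * cnj (\<Phi> $$ (a, j)))"
    by (intro sum.cong refl index_gram_cols(2)[OF \<Phi>]) auto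
  also have "\<dots> = (\<Sum>a<d. \<Sum>j<n. \<Phi> $$ (a, j) * cnj (\<Phi> $$ (a, j)))"
    by (rule sum.swap)
  also have "\<dots> = (\<Sum>a<d. (\<Phi> * mat_adjoint \<Phi>) $$ (a, a))"
    by (simp add: index_mult_adjoint[OF \<Phi> \<Phi>] del: index_mult_mat)
  also have "\<dots> = complex_of_real (d * \<alpha>)"
    by (simp add: \<Phi>\<Phi>)
  finally have "n * \<beta> = d * \<alpha>"
    unfolding of_real_eq_iff .
  also have "\<dots> < n * \<alpha>"
    using \<open>d < n\<close> \<open>\<alpha> > 0\<close> by simp
  finally have "\<beta> < \<alpha>"
    using \<open>d < n\<close> by simp
  have "\<forall>j<n. col \<Psi> j \<bullet>c col \<Psi> j = complex_of_real (\<alpha> - \<beta>)"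
    by (simp add: inner \<beta>)
  moreover have "\<forall>i<n. \<forall>j<n. i \<noteq> j \<longrightarrow> cmod (col \<Psi> i \<bullet>c col \<Psi> j) = \<gamma>"
    by (simp add: inner \<gamma>)
  ultimately show ?thesis
    unfolding is_etf_def
    using \<Psi> \<Psi>\<Psi> \<open>\<beta> < \<alpha>\<close> \<open>\<gamma> \<ge> 0\<close> \<open>\<alpha> > 0\<close> diff_gt_0_iff_gt by blast
qed

section \<open>Products across the permutation, and Hadamard orthogonality\<close>

text \<open>The product collapses from the inside: first \<open>K\<close> against its adjoint to a
  scalar, then \<open>P\<close> against its adjoint to the identity. Inner products of rows are
  therefore independent of the permutation.\<close>

lemma mult_adjoint_sandwich:
  fixes A A' P K :: "complex mat"
  assumes A: "A \<in> carrier_mat m n" and A': "A' \<in> carrier_mat m' n"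
    and P: "P \<in> carrier_mat n n" "P * mat_adjoint P = 1\<^sub>m n"
    and K: "K \<in> carrier_mat n c" "K * mat_adjoint K = s \<cdot>\<^sub>m 1\<^sub>m n"
  shows "(A * P * K) * mat_adjoint (A' * P * K) = s \<cdot>\<^sub>m (A * mat_adjoint A')"
proof -
  have AP: "A * P \<in> carrier_mat m n" and AP': "A' * P \<in> carrier_mat m' n"
    using A A' P by auto
  have "(A * P * K) * mat_adjoint (A' * P * K) = (A * P * K) * (mat_adjoint K * mat_adjoint (A' * P))"
    by (simp add: mat_adjoint_mult[OF AP' K(1)])
  also have "\<dots> = A * P * K * mat_adjoint K * mat_adjoint (A' * P)"
    using AP AP' K(1) by (intro assoc_mult_mat[symmetric, of _ m c _ n _ m']) auto
  also have "A * P * K * mat_adjoint K = A * P * (K * mat_adjoint K)"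
    using AP K(1) by (intro assoc_mult_mat[of _ m n _ c _ n]) auto
  also have "\<dots> = s \<cdot>\<^sub>m (A * P)"
    using AP by (simp add: K(2) mult_smult_distrib[of _ m n _ n] right_mult_one_mat[OF AP])
  also have "s \<cdot>\<^sub>m (A * P) * mat_adjoint (A' * P) = s \<cdot>\<^sub>m (A * P * (mat_adjoint P * mat_adjoint A'))"
    using AP mult_carrier_mat[of "mat_adjoint P" n n "mat_adjoint A'" m'] A' P
    by (simp add: mat_adjoint_mult[OF A' P(1)] mult_smult_assoc_mat[of _ m n _ m'])
  also have "A * P * (mat_adjoint P * mat_adjoint A') = A * P * mat_adjoint P * mat_adjoint A'"
    using AP A' P by (intro assoc_mult_mat[symmetric, of _ m n _ n _ m']) auto
  also have "A * P * mat_adjoint P = A * (P * mat_adjoint P)"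
    using A P(1) by (intro assoc_mult_mat[of _ m n _ n _ n]) auto
  also have "\<dots> = A"
    using A by (simp add: P(2))
  finally show ?thesis .
qed

lemma hadamard_rows:
  assumes "hadamard m H" "i < m" "j < m"
  shows "(\<Sum>a<m. H $$ (i, a) * cnj (H $$ (j, a))) = (if i = j then of_nat m else 0)"
  using assms index_mult_adjoint[of H m m H m i j] by (auto simp: hadamard_def)

text \<open>The definition of \<open>hadamard\<close> speaks about rows only; squareness transfers
  orthogonality to the columns, where the construction uses it.\<close>

lemma hadamard_columns:
  assumes "hadamard m H" "i < m" "j < m"
  shows "(\<Sum>a<m. cnj (H $$ (a, i)) * H $$ (a, j)) = (if i = j then of_nat m else 0)"
proof -
  have H: "H \<in> carrier_mat m m" using assms by (simp add: hadamard_def)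
  have "mat_adjoint H * H = of_nat m \<cdot>\<^sub>m 1\<^sub>m m"
    using assms by (intro tight_square_adjoint_mult) (auto simp: hadamard_def)
  then show ?thesis
    using index_gram_cols[OF H, of i j] index_gram_cols(2)[OF H, of j i] assms
    by (auto simp: mult.commute)
qed

section \<open>The construction for a fixed matching of slots\<close>

text \<open>The design appears only as the map from slot \<open>x * r + t\<close> to the block
  number \<open>p (x * r + t) div k\<close>. By \<open>simple\<close> the slots of one vertex lie in
  different blocks; by \<open>meet\<close> two vertices have exactly one block in common, reached
  from exactly one slot of each.\<close>

locale hadamard_construction =
  fixes v k r b :: nat and P F G :: "complex mat" and p :: "nat \<Rightarrow> nat"
  assumes pos: "0 < v" "0 < k" "0 < r" and bk: "b * k = v * r"
    and perm: "p permutes {..<b * k}"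
    and P: "P = mat (b * k) (b * k) (\<lambda>(i, j). if i = p j then 1 else 0)"
    and simple: "\<And>x t t'. x < v \<Longrightarrow> t < r \<Longrightarrow> t' < r \<Longrightarrow>
      p (x * r + t) div k = p (x * r + t') div k \<Longrightarrow> t = t'"
    and meet: "\<And>x y. x < v \<Longrightarrow> y < v \<Longrightarrow> x \<noteq> y \<Longrightarrow> \<exists>t<r. \<exists>u<r. \<forall>t'<r. \<forall>u'<r.
      p (x * r + t') div k = p (y * r + u') div k \<longleftrightarrow> t' = t \<and> u' = u"
    and F: "hadamard k F" and G: "hadamard (r + 1) G"
begin

abbreviation "\<Phi> \<equiv> Phi v k r b P F G"

text \<open>These name the matrices bound by \<open>let\<close> inside \<open>Phi\<close> and
  \<open>Phi_tilde\<close>; \<open>Z\<close> is the bottom block of the latter.\<close>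

definition "f l = mat k 1 (\<lambda>(i, _). F $$ (i, l))"

definition "G1 = mat (r + 1) r (\<lambda>(i, j). G $$ (i, j))"

definition "g2 = mat (r + 1) 1 (\<lambda>(i, _). G $$ (i, r))"

definition "Z = complex_of_real (sqrt (real k)) \<cdot>\<^sub>m (1\<^sub>m v \<otimes>\<^sub>k mat_adjoint g2)"

lemma column_carrier [simp]:
  "f l \<in> carrier_mat k (Suc 0)" "G1 \<in> carrier_mat (Suc r) r" "g2 \<in> carrier_mat (Suc r) (Suc 0)"
  "dim_row (f l) = k" "dim_col (f l) = 1" "dim_row G1 = r + 1" "dim_col G1 = r"
  "dim_row g2 = r + 1" "dim_col g2 = 1"
  by (auto simp: f_def G1_def g2_def)

lemma index_column:
  "i < k \<Longrightarrow> f l $$ (i, 0) = F $$ (i, l)"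
  "i < r + 1 \<Longrightarrow> j < r \<Longrightarrow> G1 $$ (i, j) = G $$ (i, j)"
  "i < r + 1 \<Longrightarrow> g2 $$ (i, 0) = G $$ (i, r)"
  by (auto simp: f_def G1_def g2_def)

lemma Phi_eq: "\<Phi> l = (1\<^sub>m b \<otimes>\<^sub>k mat_adjoint (f l)) * P * (1\<^sub>m v \<otimes>\<^sub>k mat_adjoint G1)"
  by (simp add: Phi_def f_def G1_def)

lemma P_carrier: "P \<in> carrier_mat (b * k) (b * k)"
  by (simp add: P)

lemma A_carrier: "1\<^sub>m b \<otimes>\<^sub>k mat_adjoint (f l) \<in> carrier_mat b (b * k)"
  by (intro carrier_matI) simp_all

lemma K_carrier: "1\<^sub>m v \<otimes>\<^sub>k mat_adjoint G1 \<in> carrier_mat (b * k) (v * (r + 1))"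
  by (intro carrier_matI) (simp_all add: bk)

lemma Z_carrier: "Z \<in> carrier_mat v (v * (r + 1))"
  unfolding Z_def by (intro carrier_matI) simp_all

lemma Phi_carrier: "\<Phi> l \<in> carrier_mat b (v * (r + 1))"
  unfolding Phi_eq using A_carrier P_carrier K_carrier by (metis mult_carrier_mat)

lemma f_gram:
  assumes "l < k" "m < k"
  shows "mat_adjoint (f l) * f m = (if l = m then of_nat k else 0) \<cdot>\<^sub>m 1\<^sub>m 1"
proof (rule eq_matI)
  fix i j assume "i < dim_row ((if l = m then of_nat k else 0) \<cdot>\<^sub>m 1\<^sub>m 1 :: complex mat)"
    "j < dim_col ((if l = m then of_nat k else 0) \<cdot>\<^sub>m 1\<^sub>m 1 :: complex mat)"
  then show "(mat_adjoint (f l) * f m) $$ (i, j) = ((if l = m then of_nat k else 0) \<cdot>\<^sub>m 1\<^sub>m 1) $$ (i, j)"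
    using hadamard_columns[OF F assms]
    by (subst index_mult_mat_sum[of _ 1 k _ 1]) (auto simp: index_column)
qed auto

lemma G1_gram: "mat_adjoint G1 * G1 = of_nat (r + 1) \<cdot>\<^sub>m 1\<^sub>m r"
proof (rule eq_matI)
  fix i j assume "i < dim_row (of_nat (r + 1) \<cdot>\<^sub>m 1\<^sub>m r :: complex mat)"
    "j < dim_col (of_nat (r + 1) \<cdot>\<^sub>m 1\<^sub>m r :: complex mat)"
  then show "(mat_adjoint G1 * G1) $$ (i, j) = (of_nat (r + 1) \<cdot>\<^sub>m 1\<^sub>m r) $$ (i, j)"
    using hadamard_columns[OF G, of i j]
    by (subst index_mult_mat_sum[of _ r "r + 1" _ r]) (auto simp: index_column)
qed auto

text \<open>The deleted column of \<open>G\<close> is orthogonal to those kept, so it spans the one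
  dimension per vertex that \<open>G1\<close> leaves free.\<close>

lemma G1_g2: "mat_adjoint G1 * g2 = 0\<^sub>m r 1"
proof (rule eq_matI)
  fix i j assume "i < dim_row (0\<^sub>m r 1 :: complex mat)" "j < dim_col (0\<^sub>m r 1 :: complex mat)"
  then show "(mat_adjoint G1 * g2) $$ (i, j) = (0\<^sub>m r 1) $$ (i, j)"
    using hadamard_columns[OF G, of i r]
    by (subst index_mult_mat_sum[of _ r "r + 1" _ 1]) (auto simp: index_column)
qed auto

lemma g2_gram: "mat_adjoint g2 * g2 = of_nat (r + 1) \<cdot>\<^sub>m 1\<^sub>m 1"
proof (rule eq_matI)
  fix i j assume "i < dim_row (of_nat (r + 1) \<cdot>\<^sub>m 1\<^sub>m 1 :: complex mat)"
    "j < dim_col (of_nat (r + 1) \<cdot>\<^sub>m 1\<^sub>m 1 :: complex mat)"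
  then show "(mat_adjoint g2 * g2) $$ (i, j) = (of_nat (r + 1) \<cdot>\<^sub>m 1\<^sub>m 1) $$ (i, j)"
    using hadamard_columns[OF G, of r r]
    by (subst index_mult_mat_sum[of _ 1 "r + 1" _ 1]) (auto simp: index_column)
qed auto

lemma Phi_mult_adjoint:
  assumes "l < k" "m < k"
  shows "\<Phi> l * mat_adjoint (\<Phi> m) = (if l = m then of_nat (k * (r + 1)) else 0) \<cdot>\<^sub>m 1\<^sub>m b"
proof -
  have "(1\<^sub>m v \<otimes>\<^sub>k mat_adjoint G1) * mat_adjoint (1\<^sub>m v \<otimes>\<^sub>k mat_adjoint G1)
      = of_nat (r + 1) \<cdot>\<^sub>m 1\<^sub>m (b * k)"
    by (simp add: mat_adjoint_kronecker kronecker_mult[of _ v v _ v _ r "r + 1" _ r] G1_gram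
        kronecker_smult_right kronecker_one bk)
  then have "\<Phi> l * mat_adjoint (\<Phi> m)
      = of_nat (r + 1) \<cdot>\<^sub>m ((1\<^sub>m b \<otimes>\<^sub>k mat_adjoint (f l)) * mat_adjoint (1\<^sub>m b \<otimes>\<^sub>k mat_adjoint (f m)))"
    unfolding Phi_eq
    by (intro mult_adjoint_sandwich[OF A_carrier A_carrier P_carrier _ K_carrier])
      (simp_all add: P permutation_mat_unitary[OF perm])
  also have "\<dots> = of_nat (r + 1) \<cdot>\<^sub>m ((if l = m then of_nat k else 0) \<cdot>\<^sub>m 1\<^sub>m b)"
    by (simp only: mat_adjoint_kronecker mat_adjoint_one mat_adjoint_adjoint)
      (simp add: kronecker_mult[of _ b b _ b _ 1 k _ 1] f_gram[OF assms]
        kronecker_smult_right kronecker_one)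
  also have "\<dots> = (if l = m then of_nat (k * (r + 1)) else 0) \<cdot>\<^sub>m 1\<^sub>m b"
    by (intro eq_matI) (auto simp: algebra_simps)
  finally show ?thesis .
qed

text \<open>The adjoint of \<open>Z\<close> is a multiple of
  \<open>1\<^sub>m v \<otimes>\<^sub>k g2\<close>, which meets the rightmost factor of
  \<open>\<Phi> l\<close> first; \<open>G1_g2\<close> annihilates that product.\<close>

lemma Phi_mult_adjoint_Z: "\<Phi> l * mat_adjoint Z = 0\<^sub>m b v"
proof -
  have AP: "(1\<^sub>m b \<otimes>\<^sub>k mat_adjoint (f l)) * P \<in> carrier_mat b (b * k)"
    using A_carrier P_carrier by (metis mult_carrier_mat)
  have g: "1\<^sub>m v \<otimes>\<^sub>k g2 \<in> carrier_mat (v * (r + 1)) v"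
    by (intro carrier_matI) simp_all
  have "(1\<^sub>m v \<otimes>\<^sub>k mat_adjoint G1) * (1\<^sub>m v \<otimes>\<^sub>k g2) = 0\<^sub>m (b * k) v"
    by (simp add: kronecker_mult[of _ v v _ v _ r "r + 1" _ 1] G1_g2
        kronecker_zero_right bk)
  then have "\<Phi> l * (1\<^sub>m v \<otimes>\<^sub>k g2) = 0\<^sub>m b v"
    unfolding Phi_eq using AP by (subst assoc_mult_mat[OF AP K_carrier g]) (simp add: right_mult_zero_mat[OF AP])
  then show ?thesis
    by (simp add: Z_def mat_adjoint_smult mat_adjoint_kronecker mult_smult_distrib[OF Phi_carrier g])
qed

text \<open>Here the factor \<open>sqrt (real k)\<close> earns its place: it lifts the squared row
  norm from r + 1 to the value k (r + 1) of the rows of every \<open>\<Phi> l\<close>.\<close>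

lemma Z_mult_adjoint: "Z * mat_adjoint Z = of_nat (k * (r + 1)) \<cdot>\<^sub>m 1\<^sub>m v"
proof -
  define s where "s = complex_of_real (sqrt (real k))"
  have s: "s * s = of_nat k" "cnj s = s"
    by (auto simp: s_def simp flip: of_real_mult)
  define g where "g = 1\<^sub>m v \<otimes>\<^sub>k mat_adjoint g2"
  have g: "g \<in> carrier_mat v (v * (r + 1))"
    unfolding g_def by (intro carrier_matI) simp_all
  have "g * mat_adjoint g = of_nat (r + 1) \<cdot>\<^sub>m 1\<^sub>m v"
    unfolding g_def
    by (simp add: mat_adjoint_kronecker kronecker_mult[of _ v v _ v _ 1 "r + 1" _ 1]
        g2_gram kronecker_smult_right kronecker_one)
  then have "(s \<cdot>\<^sub>m g) * mat_adjoint (s \<cdot>\<^sub>m g) = s \<cdot>\<^sub>m (s \<cdot>\<^sub>m (of_nat (r + 1) \<cdot>\<^sub>m 1\<^sub>m v))"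
    using g by (simp add: mat_adjoint_smult s mult_smult_distrib[of _ v "v * (r + 1)" _ v]
        mult_smult_assoc_mat[of _ v "v * (r + 1)" _ v])
  also have "\<dots> = (s * s * of_nat (r + 1)) \<cdot>\<^sub>m 1\<^sub>m v"
    by (intro eq_matI) auto
  finally show ?thesis
    by (simp add: s Z_def algebra_simps flip: s_def g_def)
qed

text \<open>A column number y encodes the vertex \<open>y div (r + 1)\<close> and the row
  \<open>y mod (r + 1)\<close> of \<open>G\<close>.\<close>

lemma index_Phi:
  assumes "l < k" "B < b" "y < v * (r + 1)"
  shows "\<Phi> l $$ (B, y) = (\<Sum>t<r. (if p (y div (r + 1) * r + t) div k = B
      then cnj (F $$ (p (y div (r + 1) * r + t) mod k, l)) else 0) * cnj (G $$ (y mod (r + 1), t)))"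
proof -
  have "\<Phi> l $$ (B, y) = (\<Sum>t<r. (if p (y div (r + 1) * r + t) div k = B
      then mat_adjoint (f l) $$ (0, p (y div (r + 1) * r + t) mod k) else 0)
        * mat_adjoint G1 $$ (t, y mod (r + 1)))"
    unfolding Phi_eq
    by (rule index_kronecker_permutation[OF perm bk _ _ assms(2,3), folded P]) auto
  also have "\<dots> = (\<Sum>t<r. (if p (y div (r + 1) * r + t) div k = B
      then cnj (F $$ (p (y div (r + 1) * r + t) mod k, l)) else 0) * cnj (G $$ (y mod (r + 1), t)))"
    using pos assms by (intro sum.cong) (auto simp: index_column)
  finally show ?thesis .
qed

lemma Phi_columns:
  assumes l: "l < k" and y: "y < v * (r + 1)" and z: "z < v * (r + 1)"
  shows "col (\<Phi> l) y \<bullet>c col (\<Phi> l) y = of_nat r"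
    and "y \<noteq> z \<Longrightarrow> cmod (col (\<Phi> l) y \<bullet>c col (\<Phi> l) z) = 1"
proof -
  \<comment> \<open>\<open>\<tau> x t\<close> is the block that holds slot t of x, and
    \<open>c x t\<close> the phase which \<open>F\<close> attaches to that slot. Since a remainder
    modulo k is always a row number of \<open>F\<close>, the phase has modulus 1 for all x and
    t.\<close>
  define \<tau> where "\<tau> x t = p (x * r + t) div k" for x t
  define c where "c x t = cnj (F $$ (p (x * r + t) mod k, l))" for x t
  have \<tau>: "\<tau> x t < b" if "x < v" "t < r" for x t
  proof -
    have "p (x * r + t) < b * k"
      using permutes_in_image[OF perm, of "x * r + t"] mult_add_less[OF that] bk by simp
    then show ?thesis unfolding \<tau>_def using div_mod_less_mult by blast
  qed
  have c: "cmod (c x t) = 1" for x t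
    using F l pos by (simp add: c_def hadamard_def)
  have G1: "cmod (G $$ (i, j)) = 1" if "i < r + 1" "j < r + 1" for i j
    using G that by (simp add: hadamard_def)
  have unit: "w * cnj w = 1" if "cmod w = 1" for w
    using that by (simp flip: complex_norm_square)
  have inner: "col (\<Phi> l) y \<bullet>c col (\<Phi> l) z = (\<Sum>t<r. \<Sum>u<r. if \<tau> x t = \<tau> x' u
      then c x t * cnj (c x' u) * (cnj (G $$ (i, t)) * G $$ (j, u)) else 0)"
    if "y < v * (r + 1)" "z < v * (r + 1)"
      "x = y div (r + 1)" "i = y mod (r + 1)" "x' = z div (r + 1)" "j = z mod (r + 1)" for y z x i x' j
  proof -
    have x: "x < v" "x' < v" using that div_mod_less_mult by blast+
    have "col (\<Phi> l) y \<bullet>c col (\<Phi> l) z = (\<Sum>B<b. \<Phi> l $$ (B, y) * cnj (\<Phi> l $$ (B, z)))"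
      using that by (intro index_gram_cols(2)[OF Phi_carrier])
    also have "\<dots> = (\<Sum>B<b. (\<Sum>t<r. (if \<tau> x t = B then c x t else 0) * cnj (G $$ (i, t)))
        * (\<Sum>u<r. (if \<tau> x' u = B then cnj (c x' u) else 0) * G $$ (j, u)))"
      using that l
      by (intro sum.cong arg_cong2[of _ _ _ _ "(*)"])
        (auto simp: index_Phi \<tau>_def c_def cnj_sum intro!: sum.cong)
    \<comment> \<open>Only pairs of slots in the same block B survive. Once the second condition is
      rewritten without B, the sum over blocks has a single term for each pair.\<close>
    also have "\<dots> = (\<Sum>B<b. \<Sum>t<r. \<Sum>u<r. if \<tau> x t = B then if \<tau> x t = \<tau> x' u
        then c x t * cnj (c x' u) * (cnj (G $$ (i, t)) * G $$ (j, u)) else 0 else 0)"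
      unfolding sum_product by (intro sum.cong) auto
    also have "\<dots> = (\<Sum>t<r. \<Sum>u<r. \<Sum>B<b. if \<tau> x t = B then if \<tau> x t = \<tau> x' u
        then c x t * cnj (c x' u) * (cnj (G $$ (i, t)) * G $$ (j, u)) else 0 else 0)"
      by (subst sum.swap) (intro sum.cong refl sum.swap)
    also have "\<dots> = (\<Sum>t<r. \<Sum>u<r. if \<tau> x t = \<tau> x' u
        then c x t * cnj (c x' u) * (cnj (G $$ (i, t)) * G $$ (j, u)) else 0)"
      using \<tau> x by (intro sum.cong) auto
    finally show ?thesis .
  qed
  \<comment> \<open>At one vertex \<open>simple\<close> leaves only the terms with u = t, where the
    phases of \<open>F\<close> cancel. What remains is a product of two rows of \<open>G\<close>
    lacking the term of column r; for equal rows it is (r + 1) - 1.\<close>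
  have same: "col (\<Phi> l) y \<bullet>c col (\<Phi> l) z
      = (if i = j then of_nat (r + 1) else 0) - cnj (G $$ (i, r)) * G $$ (j, r)"
    if "y < v * (r + 1)" "z < v * (r + 1)"
      "y div (r + 1) = z div (r + 1)" "i = y mod (r + 1)" "j = z mod (r + 1)" for y z i j
  proof -
    define x where "x = y div (r + 1)"
    have x: "x < v" using that x_def div_mod_less_mult by blast
    have ij: "i < r + 1" "j < r + 1" using that by auto
    have "col (\<Phi> l) y \<bullet>c col (\<Phi> l) z = (\<Sum>t<r. \<Sum>u<r. if \<tau> x t = \<tau> x u
        then c x t * cnj (c x u) * (cnj (G $$ (i, t)) * G $$ (j, u)) else 0)"
      using that by (intro inner) (auto simp: x_def)
    also have "\<dots> = (\<Sum>t<r. \<Sum>u<r. if u = t then cnj (G $$ (i, t)) * G $$ (j, t) else 0)"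
      using simple[OF x] unit[OF c] unfolding \<tau>_def by (intro sum.cong) auto
    also have "\<dots> = (\<Sum>t<r. G $$ (j, t) * cnj (G $$ (i, t)))"
      by (simp add: mult.commute)
    also have "\<dots> = (\<Sum>t<r + 1. G $$ (j, t) * cnj (G $$ (i, t))) - cnj (G $$ (i, r)) * G $$ (j, r)"
      by simp
    finally show ?thesis
      using hadamard_rows[OF G ij(2,1)] by (auto simp: mult.commute simp del: sum.lessThan_Suc)
  qed
  show "col (\<Phi> l) y \<bullet>c col (\<Phi> l) y = of_nat r"
    using same[OF y y] unit[OF G1[of "y mod (r + 1)" r]] by (simp add: mult.commute)
  show "cmod (col (\<Phi> l) y \<bullet>c col (\<Phi> l) z) = 1" if "y \<noteq> z"
  proof (cases "y div (r + 1) = z div (r + 1)")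
    case True
    then have "y mod (r + 1) \<noteq> z mod (r + 1)"
      using \<open>y \<noteq> z\<close> by (metis div_mult_mod_eq)
    then show ?thesis
      using same[OF y z True] G1[of "y mod (r + 1)" r] G1[of "z mod (r + 1)" r] by (simp add: norm_mult)
  next
    case False
    define x x' i j where "x = y div (r + 1)" and "x' = z div (r + 1)"
      and "i = y mod (r + 1)" and "j = z mod (r + 1)"
    note defs = this
    have "x < v" "x' < v" "x \<noteq> x'" using y z False defs div_mod_less_mult by blast+
    \<comment> \<open>A single pair (t, u) of slots survives, so the inner product is one product of
      four unimodular numbers.\<close>
    from meet[OF this] obtain t u where tu: "t < r" "u < r"
      and meet': "\<And>t' u'. t' < r \<Longrightarrow> u' < r \<Longrightarrow> \<tau> x t' = \<tau> x' u' \<longleftrightarrow> t' = t \<and> u' = u"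
      unfolding \<tau>_def by blast
    have "col (\<Phi> l) y \<bullet>c col (\<Phi> l) z = (\<Sum>t<r. \<Sum>u<r. if \<tau> x t = \<tau> x' u
        then c x t * cnj (c x' u) * (cnj (G $$ (i, t)) * G $$ (j, u)) else 0)"
      using y z by (intro inner) (auto simp: defs)
    also have "\<dots> = (\<Sum>t'<r. \<Sum>u'<r. if t' = t then if u' = u
        then c x t * cnj (c x' u) * (cnj (G $$ (i, t)) * G $$ (j, u)) else 0 else 0)"
      by (intro sum.cong) (auto simp: meet')
    also have "\<dots> = (\<Sum>t'<r. if t' = t then (\<Sum>u'<r. if u' = u
        then c x t * cnj (c x' u) * (cnj (G $$ (i, t)) * G $$ (j, u)) else 0) else 0)"
      by (intro sum.cong) auto
    also have "\<dots> = c x t * cnj (c x' u) * (cnj (G $$ (i, t)) * G $$ (j, u))"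
      using tu by simp
    finally show ?thesis
      using tu by (simp add: norm_mult c G1 defs)
  qed
qed

text \<open>Membership of the entries in \<open>K\<close> stays an assumption, so that one proof
  serves both choices of scalars.\<close>

lemma Phi_etf:
  assumes "l < k" and "\<Phi> l \<in> mat_over K b (v * (r + 1))"
  shows "is_etf K b (v * (r + 1)) (\<Phi> l)"
  unfolding is_etf_def
proof (intro conjI)
  show "\<exists>\<beta> \<gamma> \<alpha> :: real. \<beta> > 0 \<and> \<gamma> \<ge> 0 \<and> \<alpha> > 0 \<and>
      (\<forall>j<v * (r + 1). col (\<Phi> l) j \<bullet>c col (\<Phi> l) j = complex_of_real \<beta>) \<and>
      (\<forall>i<v * (r + 1). \<forall>j<v * (r + 1). i \<noteq> j \<longrightarrow> cmod (col (\<Phi> l) i \<bullet>c col (\<Phi> l) j) = \<gamma>) \<and>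
      \<Phi> l * mat_adjoint (\<Phi> l) = complex_of_real \<alpha> \<cdot>\<^sub>m 1\<^sub>m b"
  proof (rule exI[of _ "real r"], rule exI[of _ 1], rule exI[of _ "real (k * (r + 1))"], intro conjI allI impI)
    show "0 < real (k * (r + 1))"
      using pos by (simp only: of_nat_0_less_iff) simp
    show "\<Phi> l * mat_adjoint (\<Phi> l) = complex_of_real (real (k * (r + 1))) \<cdot>\<^sub>m 1\<^sub>m b"
      by (simp add: Phi_mult_adjoint[OF assms(1,1)])
  qed (use pos Phi_columns[OF assms(1)] in simp_all)
qed (rule assms(2))

lemma Phi_row_spaces:
  assumes "l < k" "m < k" "l \<noteq> m"
  shows "orthogonal_spaces (row_space_over K (\<Phi> l)) (row_space_over K (\<Phi> m))"
proof (rule orthogonal_row_spaces[OF Phi_carrier Phi_carrier])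
  show "\<Phi> l * mat_adjoint (\<Phi> m) = 0\<^sub>m b b"
    using assms by (simp add: Phi_mult_adjoint) (intro eq_matI, auto)
qed

text \<open>The stack is square by the count k b + v = v r + v = v (r + 1). Its rows are pairwise
  orthogonal with common squared norm k (r + 1), which is the \<alpha> of the ETF.\<close>

lemma Phi_naimark:
  assumes "\<And>l. l < k \<Longrightarrow> \<Phi> l \<in> mat_over K b (v * (r + 1))" "Z \<in> mat_over K v (v * (r + 1))"
  shows "naimark_complement K b (v * (r + 1)) (\<Phi> 0) (Phi_tilde v k r b P F G)"
proof -
  let ?\<Psi> = "Phi_tilde v k r b P F G"
  have \<Psi>: "?\<Psi> = foldr (@\<^sub>r) (map \<Phi> [1..<k]) Z"
    by (simp add: Phi_tilde_def Z_def g2_def)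
  \<comment> \<open>A complement needs more vectors than dimensions: b is at most b k = v r.\<close>
  have "b * 1 \<le> b * k" using pos by (intro mult_le_mono2) simp
  then have less: "b < v * (r + 1)" using bk pos by simp
  have "length [1..<k] * b + v = k * b + v - b"
    using pos by (simp add: diff_mult_distrib)
  then have rows: "length [1..<k] * b + v = v * (r + 1) - b"
    using bk by (simp add: mult.commute)
  have \<Psi>_over: "?\<Psi> \<in> mat_over K (v * (r + 1) - b) (v * (r + 1))"
    unfolding \<Psi> rows[symmetric] using assms by (intro mat_over_foldr_append_rows) auto
  have stack: "\<Phi> 0 @\<^sub>r ?\<Psi> = foldr (@\<^sub>r) (map \<Phi> [0..<k]) Z"
    unfolding \<Psi> using pos by (simp add: upt_conv_Cons)
  have len: "length [0..<k] * b + v = v * (r + 1)" using bk by (simp add: mult.commute)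
  have tight: "(\<Phi> 0 @\<^sub>r ?\<Psi>) * mat_adjoint (\<Phi> 0 @\<^sub>r ?\<Psi>) = of_nat (k * (r + 1)) \<cdot>\<^sub>m 1\<^sub>m (v * (r + 1))"
    unfolding stack len[symmetric]
    by (intro foldr_append_rows_tight[OF Z_carrier Z_mult_adjoint])
      (auto simp: Phi_carrier[simplified] Phi_mult_adjoint_Z Phi_mult_adjoint[simplified] zero_smult_mat[of _ b b])
  have U: "\<Phi> 0 @\<^sub>r ?\<Psi> \<in> carrier_mat (v * (r + 1)) (v * (r + 1))"
    using carrier_append_rows[OF Phi_carrier, of ?\<Psi> "v * (r + 1) - b" 0] \<Psi>_over less
    by (simp add: mat_over_def)
  have "0 < real (k * (r + 1))" using pos by (simp only: of_nat_0_less_iff) simp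
  note unitary_mat_scaled_iff[OF U this]
  then have "unitary_mat (v * (r + 1)) (complex_of_real (1 / sqrt (real (k * (r + 1)))) \<cdot>\<^sub>m (\<Phi> 0 @\<^sub>r ?\<Psi>))"
    using tight by simp
  moreover have "\<Phi> 0 * mat_adjoint (\<Phi> 0) = complex_of_real (real (k * (r + 1))) \<cdot>\<^sub>m 1\<^sub>m b"
    using pos by (simp add: Phi_mult_adjoint)
  ultimately show ?thesis
    unfolding naimark_complement_def
    using Phi_etf[OF pos(2) assms(1)[OF pos(2)]] less \<Psi>_over \<open>0 < real (k * (r + 1))\<close> by blast
qed

lemma Phi_real:
  assumes "real_hadamard k F" "real_hadamard (r + 1) G" "l < k"
  shows "\<Phi> l \<in> mat_over \<real> b (v * (r + 1))" and "Z \<in> mat_over \<real> v (v * (r + 1))"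
proof -
  have F': "cnj (F $$ (i, l)) \<in> \<real>" if "i < k" for i
  proof -
    have "F $$ (i, l) \<in> {1, -1}" using assms that by (simp add: real_hadamard_def)
    then show ?thesis by auto
  qed
  have G': "cnj (G $$ (i, j)) \<in> \<real>" if "i < r + 1" "j < r + 1" for i j
  proof -
    have "G $$ (i, j) \<in> {1, -1}" using assms that by (simp add: real_hadamard_def)
    then show ?thesis by auto
  qed
  have "\<Phi> l $$ (B, y) \<in> \<real>" if "B < b" "y < v * (r + 1)" for B y
    unfolding index_Phi[OF assms(3) that] using F' G' pos
    by (intro sum_in_Reals Reals_mult) auto
  then show "\<Phi> l \<in> mat_over \<real> b (v * (r + 1))"
    using Phi_carrier by (simp add: mat_over_iff)
  have "Z $$ (i, j) \<in> \<real>" if "i < v" "j < v * (r + 1)" for i j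
    using that G' div_mod_less_mult[OF that(2)]
    by (auto simp: Z_def index_kronecker index_column)
  then show "Z \<in> mat_over \<real> v (v * (r + 1))"
    using Z_carrier unfolding mat_over_iff by blast
qed

end

section \<open>Counting in block designs, and the sizes of real Hadamard matrices\<close>

text \<open>Trades points and a multiset of blocks for a relation between row and column numbers.
  Blocks are counted by their positions in the enumeration, so multiplicities are respected.\<close>

lemma incidence_matrix_relation:
  assumes "bibd V \<B> v k lam r b" "incidence_matrix V \<B> X"
  obtains e where "X = mat b v (\<lambda>(i, j). if e i j then 1 else 0)"
    and "\<And>i. i < b \<Longrightarrow> card {j \<in> {..<v}. e i j} = k"
    and "\<And>j. j < v \<Longrightarrow> card {i \<in> {..<b}. e i j} = r"
    and "\<And>j j'. j < v \<Longrightarrow> j' < v \<Longrightarrow> j \<noteq> j' \<Longrightarrow> card {i \<in> {..<b}. e i j \<and> e i j'} = lam"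
proof -
  from assms(2) obtain vs bs where vs: "distinct vs" "set vs = V" and bs: "mset bs = \<B>"
    and X: "X = mat (length bs) (length vs) (\<lambda>(i, j). if vs ! j \<in> bs ! i then 1 else 0)"
    unfolding incidence_matrix_def by blast
  have len: "length vs = v" "length bs = b"
    using assms(1) distinct_card[OF vs(1)] size_mset[of bs] by (simp_all add: bibd_def vs(2) bs)
  have filter: "size (filter_mset Q \<B>) = card {i \<in> {..<b}. Q (bs ! i)}" for Q
    unfolding bs[symmetric] using len by (simp add: length_filter_conv_card flip: mset_filter)
  show thesis
  proof (rule that[of "\<lambda>i j. vs ! j \<in> bs ! i"])
    show "X = mat b v (\<lambda>(i, j). if vs ! j \<in> bs ! i then 1 else 0)"
      using X len by simp
  next
    fix i assume "i < b"
    then have "bs ! i \<in># \<B>"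
      unfolding bs[symmetric] using len by simp
    then have B: "bs ! i \<subseteq> V" "card (bs ! i) = k"
      using assms(1) by (auto simp: bibd_def)
    have "inj_on ((!) vs) {j \<in> {..<v}. vs ! j \<in> bs ! i}"
      using vs(1) len by (auto simp: inj_on_def nth_eq_iff_index_eq)
    moreover have "(!) vs ` {j \<in> {..<v}. vs ! j \<in> bs ! i} = bs ! i"
      using B(1) vs(2) len by (force simp: in_set_conv_nth image_iff)
    ultimately show "card {j \<in> {..<v}. vs ! j \<in> bs ! i} = k"
      using B(2) by (metis card_image)
  next
    fix j assume "j < v"
    then have "vs ! j \<in> V" using vs len by auto
    then have "size (filter_mset (\<lambda>B. vs ! j \<in> B) \<B>) = r"
      using assms(1) by (simp add: bibd_def)
    then show "card {i \<in> {..<b}. vs ! j \<in> bs ! i} = r"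
      unfolding filter .
  next
    fix j j' assume j: "j < v" "j' < v" "j \<noteq> j'"
    then have "vs ! j \<in> V" "vs ! j' \<in> V" "vs ! j \<noteq> vs ! j'"
      using vs len by (auto simp: nth_eq_iff_index_eq)
    then have "size (filter_mset (\<lambda>B. vs ! j \<in> B \<and> vs ! j' \<in> B) \<B>) = lam"
      using assms(1) by (simp add: bibd_def)
    then show "card {i \<in> {..<b}. vs ! j \<in> bs ! i \<and> vs ! j' \<in> bs ! i} = lam"
      unfolding filter .
  qed
qed

text \<open>Double counting: of all incidences for the first identity, and of pairs (block through
  vertex 0, further vertex on it) for the second, where \<lambda> = 1 makes each further vertex
  count once. The bounds follow from k < v, as k = 1 would give v = 1 and r at most 1 would give v
  at most k.\<close>

lemma bibd_parameters:
  assumes "bibd V \<B> v k 1 r b" "incidence_matrix V \<B> X"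
  shows "b * k = v * r" and "r * (k - 1) = v - 1" and "2 \<le> k" and "2 \<le> r"
proof -
  have kv: "0 < k" "k < v" using assms(1) by (auto simp: bibd_def)
  obtain e where "X = mat b v (\<lambda>(i, j). if e i j then 1 else 0)"
    and card_row: "\<And>i. i < b \<Longrightarrow> card {j \<in> {..<v}. e i j} = k"
    and card_col: "\<And>j. j < v \<Longrightarrow> card {i \<in> {..<b}. e i j} = r"
    and card_pair: "\<And>j j'. j < v \<Longrightarrow> j' < v \<Longrightarrow> j \<noteq> j' \<Longrightarrow> card {i \<in> {..<b}. e i j \<and> e i j'} = 1"
    by (rule incidence_matrix_relation[OF assms]) (rule that)
  have "b * k = (\<Sum>i<b. card {j \<in> {..<v}. e i j})"
    using card_row by simp
  also have "\<dots> = r * card {..<v}"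
    by (rule sum_multicount) (use card_col in auto)
  finally show "b * k = v * r" by simp
  have "r * (k - 1) = (\<Sum>i\<in>{i \<in> {..<b}. e i 0}. card {j \<in> {1..<v}. e i j})"
  proof -
    have "card {j \<in> {1..<v}. e i j} = k - 1" if "i < b" "e i 0" for i
    proof -
      have "{j \<in> {1..<v}. e i j} = {j \<in> {..<v}. e i j} - {0}" by auto
      then show ?thesis using card_row[OF that(1)] that(2) kv by simp
    qed
    then show ?thesis using card_col[of 0] kv by simp
  qed
  also have "\<dots> = 1 * card {1..<v}"
  proof (rule sum_multicount)
    show "\<forall>j\<in>{1..<v}. card {i \<in> {i \<in> {..<b}. e i 0}. e i j} = 1"
      using card_pair[of 0] by auto
  qed auto
  finally show eq: "r * (k - 1) = v - 1" by simp
  show "2 \<le> k"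
  proof (rule ccontr)
    assume "\<not> 2 \<le> k"
    then have "k - 1 = 0" by simp
    then have "v - 1 = 0" using eq by (metis mult_0_right)
    with kv show False by linarith
  qed
  show "2 \<le> r"
  proof (rule ccontr)
    assume "\<not> 2 \<le> r"
    then have "r * (k - 1) \<le> 1 * (k - 1)" by (intro mult_le_mono1) simp
    with eq kv show False by linarith
  qed
qed

text \<open>The factorisation of \<open>X\<close> is a statement about counts: the entry at block i
  and vertex x is the number of slots of x that \<open>p\<close> sends into i. As \<open>X\<close>
  has entries 0 and 1, each block through x receives exactly one slot and no other block receives
  any.\<close>

lemma bibd_hadamard_construction:
  assumes bibd: "bibd V \<B> v k 1 r b" and X: "incidence_matrix V \<B> X"
    and P: "bibd_permutation_mat v k r b X P" and F: "hadamard k F" and G: "hadamard (r + 1) G"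
  obtains p where "hadamard_construction v k r b P F G p"
proof -
  note par = bibd_parameters[OF bibd X]
  obtain e where X_eq: "X = mat b v (\<lambda>(i, j). if e i j then 1 else 0)"
    and "\<And>i. i < b \<Longrightarrow> card {j \<in> {..<v}. e i j} = k"
    and "\<And>j. j < v \<Longrightarrow> card {i \<in> {..<b}. e i j} = r"
    and card_pair: "\<And>j j'. j < v \<Longrightarrow> j' < v \<Longrightarrow> j \<noteq> j' \<Longrightarrow> card {i \<in> {..<b}. e i j \<and> e i j'} = 1"
    by (rule incidence_matrix_relation[OF bibd X]) (rule that)
  from P obtain p where perm: "p permutes {..<b * k}"
    and P_eq: "P = mat (b * k) (b * k) (\<lambda>(i, j). if i = p j then 1 else 0)"
    and X_prod: "X = (1\<^sub>m b \<otimes>\<^sub>k ones_mat 1 k) * P * (1\<^sub>m v \<otimes>\<^sub>k ones_mat r 1)"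
    unfolding bibd_permutation_mat_def permutation_mat_def by blast
  have pos: "0 < v" "0 < k" using bibd by (auto simp: bibd_def)
  define \<tau> where "\<tau> x t = p (x * r + t) div k" for x t
  have \<tau>_less: "\<tau> x t < b" if "x < v" "t < r" for x t
  proof -
    have "p (x * r + t) < b * k"
      using permutes_in_image[OF perm, of "x * r + t"] mult_add_less[OF that] par(1) by simp
    then show ?thesis unfolding \<tau>_def using div_mod_less_mult by blast
  qed
  have card_\<tau>: "card {t \<in> {..<r}. \<tau> x t = i} = (if e i x then 1 else 0)" if "i < b" "x < v" for i x
  proof -
    \<comment> \<open>The factor \<open>ones_mat r 1\<close> has one column, so vertex and inner
      column number are \<open>x div 1\<close> and \<open>x mod 1\<close>.\<close>
    have "X $$ (i, x) = (\<Sum>t<r. (if p (x div 1 * r + t) div k = i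
        then ones_mat 1 k $$ (0, p (x div 1 * r + t) mod k) else 0) * ones_mat r 1 $$ (t, x mod 1))"
      unfolding X_prod using that
      by (intro index_kronecker_permutation[OF perm par(1), folded P_eq]) (auto simp: ones_mat_def)
    also have "\<dots> = (\<Sum>t<r. if \<tau> x t = i then 1 else 0)"
      using pos by (intro sum.cong) (auto simp: ones_mat_def \<tau>_def)
    also have "\<dots> = of_nat (card {t \<in> {..<r}. \<tau> x t = i})"
      by (simp add: sum.If_cases Int_def)
    finally have "complex_of_nat (card {t \<in> {..<r}. \<tau> x t = i}) = X $$ (i, x)"
      by (rule sym)
    also have "\<dots> = of_nat (if e i x then 1 else 0)"
      using that by (simp add: X_eq)
    finally show ?thesis unfolding of_nat_eq_iff .
  qed
  have e_\<tau>: "e (\<tau> x t) x" if "x < v" "t < r" for x t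
  proof -
    have "t \<in> {t' \<in> {..<r}. \<tau> x t' = \<tau> x t}" using that by simp
    then have "card {t' \<in> {..<r}. \<tau> x t' = \<tau> x t} \<noteq> 0" by (subst card_0_eq) auto
    then show ?thesis using card_\<tau>[OF \<tau>_less[OF that] that(1)] by (simp split: if_splits)
  qed
  have ex_\<tau>: "\<exists>t<r. \<tau> x t = i" if "x < v" "i < b" "e i x" for x i
  proof -
    have "card {t \<in> {..<r}. \<tau> x t = i} = 1" using card_\<tau> that by simp
    then show ?thesis by (metis (mono_tags, lifting) card_1_singletonE insertI1 lessThan_iff mem_Collect_eq)
  qed
  have inj: "t = t'" if "x < v" "t < r" "t' < r" "\<tau> x t = \<tau> x t'" for x t t'
  proof -
    have "card {u \<in> {..<r}. \<tau> x u = \<tau> x t} = 1"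
      using card_\<tau>[OF \<tau>_less[OF that(1,2)] that(1)] e_\<tau>[OF that(1,2)] by simp
    then obtain w where "{u \<in> {..<r}. \<tau> x u = \<tau> x t} = {w}" by (rule card_1_singletonE)
    moreover have "t \<in> {u \<in> {..<r}. \<tau> x u = \<tau> x t}" "t' \<in> {u \<in> {..<r}. \<tau> x u = \<tau> x t}"
      using that by auto
    ultimately show ?thesis by (metis singletonD)
  qed
  have meet: "\<exists>t<r. \<exists>u<r. \<forall>t'<r. \<forall>u'<r. \<tau> x t' = \<tau> y u' \<longleftrightarrow> t' = t \<and> u' = u"
    if xy: "x < v" "y < v" "x \<noteq> y" for x y
  proof -
    \<comment> \<open>\<lambda> = 1 supplies the common block, \<open>ex_\<tau>\<close> a slot of
      each vertex in it, and \<open>inj\<close> the uniqueness of these slots.\<close>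
    obtain i where i: "{i \<in> {..<b}. e i x \<and> e i y} = {i}"
      using card_pair[OF xy] by (rule card_1_singletonE)
    then have "i < b" "e i x" "e i y" by auto
    with ex_\<tau> xy obtain t u where tu: "t < r" "\<tau> x t = i" "u < r" "\<tau> y u = i" by metis
    have "t' = t \<and> u' = u" if "t' < r" "u' < r" "\<tau> x t' = \<tau> y u'" for t' u'
    proof -
      have "\<tau> x t' \<in> {i \<in> {..<b}. e i x \<and> e i y}"
        using that xy \<tau>_less e_\<tau> by (metis (mono_tags, lifting) lessThan_iff mem_Collect_eq)
      then have "\<tau> x t' = i" unfolding i by simp
      then show ?thesis using inj xy tu that by metis
    qed
    then show ?thesis using tu by metis
  qed
  have "hadamard_construction v k r b P F G p"
    by unfold_locales
      (use pos par(1,4) perm P_eq F G inj meet in \<open>auto simp: \<tau>_def\<close>)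
  then show thesis by (rule that)
qed

(* For three distinct rows x, y, z the sum of (x + y) (x + z) is m, and every term is 0 or 4. *)
lemma real_hadamard_4_dvd:
  assumes H: "real_hadamard m H" and "2 < m"
  shows "4 dvd m"
proof -
  define h :: "nat \<Rightarrow> nat \<Rightarrow> int" where "h i j = (if H $$ (i, j) = 1 then 1 else -1)" for i j
  have H_h: "H $$ (i, j) = of_int (h i j)" if "i < m" "j < m" for i j
    using H that by (auto simp: real_hadamard_def h_def)
  have rows: "(\<Sum>a<m. h i a * h j a) = (if i = j then int m else 0)" if "i < m" "j < m" for i j
  proof -
    have "complex_of_int (\<Sum>a<m. h i a * h j a) = (\<Sum>a<m. H $$ (i, a) * cnj (H $$ (j, a)))"
      using that by (simp add: H_h)
    also have "\<dots> = of_int (if i = j then int m else 0)"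
      using H that by (simp add: real_hadamard_def hadamard_rows)
    finally show ?thesis unfolding of_int_eq_iff .
  qed
  have "(\<Sum>a<m. (h 0 a + h 1 a) * (h 0 a + h 2 a)) = int m"
    using \<open>2 < m\<close> by (simp add: algebra_simps sum.distrib rows)
  moreover have "4 dvd (\<Sum>a<m. (h 0 a + h 1 a) * (h 0 a + h 2 a))"
    by (rule dvd_sum) (auto simp: h_def)
  ultimately have "int 4 dvd int m" by simp
  then show ?thesis unfolding of_nat_dvd_iff .
qed

text \<open>Supplies \<open>F\<close> in the case k = 2.\<close>

lemma real_hadamard_2: "\<exists>F. real_hadamard 2 F"
proof
  define F :: "complex mat" where "F = mat 2 2 (\<lambda>(i, j). if i = 1 \<and> j = 1 then -1 else 1)"
  have F: "F \<in> carrier_mat 2 2" by (simp add: F_def)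
  have "F * mat_adjoint F = of_nat 2 \<cdot>\<^sub>m 1\<^sub>m 2"
  proof (rule eq_matI)
    fix i j assume "i < dim_row (of_nat 2 \<cdot>\<^sub>m 1\<^sub>m 2 :: complex mat)" "j < dim_col (of_nat 2 \<cdot>\<^sub>m 1\<^sub>m 2 :: complex mat)"
    then have "i < 2" "j < 2" by auto
    then show "(F * mat_adjoint F) $$ (i, j) = (of_nat 2 \<cdot>\<^sub>m 1\<^sub>m 2) $$ (i, j)"
      by (subst index_mult_adjoint[OF F F])
        (auto simp: F_def less_2_cases_iff numeral_2_eq_2)
  qed (use F in auto)
  then show "real_hadamard 2 F"
    using F by (auto simp: real_hadamard_def hadamard_def F_def)
qed

text \<open>If \<open>4 dvd k\<close> then \<open>b * k = v * r\<close> is divisible by 4, but \<open>r mod 4 = 3\<close> forces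
  \<open>v = r * (k - 1) + 1\<close> and \<open>v * r\<close> to be 2 modulo 4.\<close>

lemma bibd_real_hadamard_parameters:
  assumes bk: "b * k = v * r" and v: "r * (k - 1) = v - 1" "0 < v" and "2 \<le> k" "2 \<le> r"
    and F: "real_hadamard k F" and G: "real_hadamard (r + 1) G"
  shows "k = 2" and "v = r + 1"
proof -
  show "k = 2"
  proof (rule ccontr)
    assume "k \<noteq> 2"
    then have "2 < k" using \<open>2 \<le> k\<close> by linarith
    then have "4 dvd k" by (rule real_hadamard_4_dvd[OF F])
    then obtain q where "k = 4 * q" by blast
    with \<open>2 < k\<close> have "k - 1 = 4 * (q - 1) + 3" by simp
    then have k: "(k - 1) mod 4 = 3" by simp
    have "2 < r + 1" using \<open>2 \<le> r\<close> by linarith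
    then have "4 dvd r + 1" by (rule real_hadamard_4_dvd[OF G])
    then have r: "r mod 4 = 3" using mod_Suc[of r 4] by (simp add: dvd_eq_mod_eq_0 split: if_splits)
    have "v = r * (k - 1) + 1" using v by linarith
    then have "v mod 4 = ((r mod 4) * ((k - 1) mod 4) + 1) mod 4"
      by (metis mod_add_left_eq mod_mult_eq)
    then have "v mod 4 = 2" by (simp only: k r) simp
    then have "(v * r) mod 4 = (2 * 3) mod 4"
      using r mod_mult_eq[of v 4 r] by metis
    then have "(v * r) mod 4 = 2" by simp
    moreover have "4 dvd b * k" using \<open>4 dvd k\<close> by (rule dvd_mult)
    ultimately show False unfolding bk by (simp add: dvd_eq_mod_eq_0)
  qed
  then show "v = r + 1" using v by simp
qed

theorem theorem1:
  fixes V :: "'p set" and \<B> :: "'p set multiset" and v k r b :: nat and X :: "complex mat"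
  assumes "bibd V \<B> v k 1 r b"
    and "incidence_matrix V \<B> X"
  shows
    "(\<forall>P F G. bibd_permutation_mat v k r b X P \<and> hadamard k F \<and> hadamard (r + 1) G \<longrightarrow>
        (let K = (if real_hadamard k F \<and> real_hadamard (r + 1) G then \<real> else UNIV);
             \<Phi> = Phi v k r b P F G
         in (\<forall>l<k. is_etf K b (v * (r + 1)) (\<Phi> l)) \<and>
            (\<forall>l<k. \<forall>m<k. l \<noteq> m \<longrightarrow>
               orthogonal_spaces (row_space_over K (\<Phi> l)) (row_space_over K (\<Phi> m))) \<and>
            naimark_complement K b (v * (r + 1)) (\<Phi> 0) (Phi_tilde v k r b P F G)))
     \<and> ((\<exists>F G. real_hadamard k F \<and> real_hadamard (r + 1) G) \<longleftrightarrow>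
          k = 2 \<and> (\<exists>H. real_hadamard v H))
     \<and> (\<forall>P F G. bibd_permutation_mat v k r b X P \<and>
            real_hadamard k F \<and> real_hadamard (r + 1) G \<longrightarrow>
          is_etf \<real> (v * (v - 1) div 2) (v\<^sup>2) (Phi v k r b P F G 0) \<and>
          is_etf \<real> (v * (v + 1) div 2) (v\<^sup>2) (Phi_tilde v k r b P F G))"
proof (intro conjI allI impI)
  note par = bibd_parameters[OF assms]
  have v: "0 < v" using assms(1) by (auto simp: bibd_def)
  {
    fix P F G
    assume asm: "bibd_permutation_mat v k r b X P \<and> hadamard k F \<and> hadamard (r + 1) G"
    define K where "K = (if real_hadamard k F \<and> real_hadamard (r + 1) G then \<real> else (UNIV :: complex set))"
    obtain p where "hadamard_construction v k r b P F G p"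
      using bibd_hadamard_construction[OF assms] asm by blast
    then interpret hadamard_construction v k r b P F G p .
    have K: "\<Phi> l \<in> mat_over K b (v * (r + 1))" "Z \<in> mat_over K v (v * (r + 1))" if "l < k" for l
    proof -
      have "\<Phi> l \<in> mat_over K b (v * (r + 1)) \<and> Z \<in> mat_over K v (v * (r + 1))"
      proof (cases "real_hadamard k F \<and> real_hadamard (r + 1) G")
        case True
        then have "K = \<real>" by (simp add: K_def)
        then show ?thesis using Phi_real True that by blast
      next
        case False
        then have "K = UNIV" by (simp only: K_def if_False)
        then show ?thesis using Phi_carrier Z_carrier unfolding mat_over_iff by blast
      qed
      then show "\<Phi> l \<in> mat_over K b (v * (r + 1))" "Z \<in> mat_over K v (v * (r + 1))" by auto
    qed
    show "let K = (if real_hadamard k F \<and> real_hadamard (r + 1) G then \<real> else UNIV);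
             \<Phi> = Phi v k r b P F G
         in (\<forall>l<k. is_etf K b (v * (r + 1)) (\<Phi> l)) \<and>
            (\<forall>l<k. \<forall>m<k. l \<noteq> m \<longrightarrow>
               orthogonal_spaces (row_space_over K (\<Phi> l)) (row_space_over K (\<Phi> m))) \<and>
            naimark_complement K b (v * (r + 1)) (\<Phi> 0) (Phi_tilde v k r b P F G)"
      unfolding Let_def K_def[symmetric]
      using Phi_etf Phi_row_spaces Phi_naimark[OF K(1) K(2)[OF pos(2)]] K(1) by blast
  }
  note main = this
  show "(\<exists>F G. real_hadamard k F \<and> real_hadamard (r + 1) G) \<longleftrightarrow> k = 2 \<and> (\<exists>H. real_hadamard v H)"
  proof
    assume "\<exists>F G. real_hadamard k F \<and> real_hadamard (r + 1) G"
    then show "k = 2 \<and> (\<exists>H. real_hadamard v H)"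
      using bibd_real_hadamard_parameters[OF par(1,2) v par(3,4)] by metis
  next
    assume H: "k = 2 \<and> (\<exists>H. real_hadamard v H)"
    \<comment> \<open>With k = 2 the size required of \<open>G\<close> is v, so the given matrix
      \<open>H\<close> itself serves.\<close>
    then have "v = r + 1" using par(2) v by simp
    then show "\<exists>F G. real_hadamard k F \<and> real_hadamard (r + 1) G"
      using H real_hadamard_2 by blast
  qed
  fix P F G
  assume asm: "bibd_permutation_mat v k r b X P \<and> real_hadamard k F \<and> real_hadamard (r + 1) G"
  then have k: "k = 2" and r: "v = r + 1"
    using bibd_real_hadamard_parameters[OF par(1,2) v par(3,4)] by blast+
  have "bibd_permutation_mat v k r b X P \<and> hadamard k F \<and> hadamard (r + 1) G"
    using asm by (simp add: real_hadamard_def)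
  \<comment> \<open>The real hypotheses make the conditional in \<open>main\<close> choose
    \<open>\<real>\<close>, and k = 2 admits the index 0.\<close>
  from main[OF this] asm have etf: "is_etf \<real> b (v * (r + 1)) (Phi v k r b P F G 0)"
    and naimark: "naimark_complement \<real> b (v * (r + 1)) (Phi v k r b P F G 0) (Phi_tilde v k r b P F G)"
    by (auto simp: Let_def k)
  have n: "v * (r + 1) = v\<^sup>2"
    by (simp add: r power2_eq_square)
  \<comment> \<open>This is b k = v r with k = 2 and r = v - 1; every pair of vertices is a
    block.\<close>
  have twice: "2 * b = v * (v - 1)"
    using par(1) k r by simp
  then have b: "b = v * (v - 1) div 2" by simp
  \<comment> \<open>The complement lives in dimension \<open>v\<^sup>2 - b\<close>, and twice this
    is \<open>2 * v\<^sup>2 - v * (v - 1)\<close>.\<close>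
  have "v * (v + 1) = 2 * (v\<^sup>2 - b)"
    using twice v by (simp add: diff_mult_distrib2 power2_eq_square algebra_simps)
  then have c: "v\<^sup>2 - b = v * (v + 1) div 2" by simp
  show "is_etf \<real> (v * (v - 1) div 2) (v\<^sup>2) (Phi v k r b P F G 0)"
    using etf unfolding n b[symmetric] .
  show "is_etf \<real> (v * (v + 1) div 2) (v\<^sup>2) (Phi_tilde v k r b P F G)"
    using naimark_complement_etf[OF naimark] unfolding n c .
qed

end
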